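(* Let $k$ be a field of characteristic zero, let $n\ge 1$, and let $F=\prod_{i=0}^{r}L_i\in k[X_0,\ldots,X_n]$ be a square-free product of nonzero linear forms $L_0,\ldots,L_r$. Suppose that $F$ is homaloidal. Then $r=n$ and the linear forms $L_0,\ldots,L_n$ are linearly independent, so that the polar map $\partial F:\mathbb{P}^n\dashrightarrow\mathbb{P}^{n*}$ is a composition of a projectivity and of a standard Cremona transformation.
   Context: Let $\mathbb{P}^n$ be projective space over a field $k$ of characteristic zero with homogeneous coordinates $X_0,\ldots,X_n$. For a homogeneous polynomial $F$ of degree $d\ge 1$, the polar map of $F$ is the rational map $\partial F:\mathbb{P}^n\dashrightarrow\mathbb{P}^{n*}$, $p\mapsto\left[\frac{\partial F}{\partial X_0}(p):\cdots:\frac{\partial F}{\partial X_n}(p)\right]$, and the polar system $|\partial F|$ is the linear system spanned by the partial derivatives of $F$. Its moving part $|M(\partial F)|$ is the linear system obtained by removing all base components, i.e. by dividing all the partial derivatives by their greatest common divisor. The polynomial $F$ is called homaloidal if the rational map $\mathbb{P}^n\dashrightarrow\mathbb{P}^{n*}$ induced by $|M(\partial F)|$ is birational. (When $F$ is square-free, the polar system has no base components.) A projectivity is an isomorphism between projective spaces induced by an invertible linear map. A standard Cremona transformation is a map which, with respect to some system of homogeneous coordinates $Y_0,\ldots,Y_n$ on the source and a corresponding choice of homogeneous coordinates on the target, is the polar map of $Y_0\cdots Y_n$, i.e. $[y_0:\cdots:y_n]\mapsto\left[\prod_{i\ne 0}y_i:\cdots:\prod_{i\neq n}y_i\right]$.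 *)

theory Defs
  imports
    "HOL-Library.Poly_Mapping"
    "HOL-Computational_Algebra.Squarefree"
    "Jordan_Normal_Form.Matrix"
begin

section \<open>Polynomials\<close>

text \<open>
  The polynomial ring \<open>k[X\<^sub>0, \<dots>, X\<^sub>n]\<close> is the subring of \<open>k[X\<^sub>0, X\<^sub>1, \<dots>]\<close> of those polynomials
  in which only the variables with index at most \<open>n\<close> occur. A divisor of a nonzero element of this
  subring lies in it again, so divisibility, greatest common divisors and square-freeness of its
  nonzero elements mean the same in both rings.
\<close>

type_synonym 'a mpoly = "(nat \<Rightarrow>\<^sub>0 nat) \<Rightarrow>\<^sub>0 'a"

definition Const :: "'a::zero \<Rightarrow> 'a mpoly" where
  "Const c = Poly_Mapping.single 0 c"

definition Var :: "nat \<Rightarrow> 'a::zero_neq_one mpoly" where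
  "Var i = Poly_Mapping.single (Poly_Mapping.single i 1) 1"

text \<open>The zero polynomial is homogeneous of every degree.\<close>

definition homogeneous :: "nat \<Rightarrow> nat \<Rightarrow> 'a::zero mpoly \<Rightarrow> bool" where
  "homogeneous n d p \<longleftrightarrow>
     (\<forall>m \<in> Poly_Mapping.keys p.
        Poly_Mapping.keys m \<subseteq> {..n} \<and> (\<Sum>i\<le>n. Poly_Mapping.lookup m i) = d)"

abbreviation linear_form :: "nat \<Rightarrow> 'a::zero mpoly \<Rightarrow> bool" where
  "linear_form n \<equiv> homogeneous n 1"

text \<open>
  If \<open>X\<^sub>i\<close> does not occur in the monomial \<open>m\<close>, the truncated difference is \<open>m\<close> itself, but then the
  coefficient vanishes.
\<close>

definition partial_deriv :: "nat \<Rightarrow> 'a::comm_semiring_1 mpoly \<Rightarrow> 'a mpoly" where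
  "partial_deriv i p =
     (\<Sum>m \<in> Poly_Mapping.keys p.
        Poly_Mapping.single (m - Poly_Mapping.single i 1)
          (Poly_Mapping.lookup p m * of_nat (Poly_Mapping.lookup m i)))"

definition subst :: "(nat \<Rightarrow> 'a mpoly) \<Rightarrow> 'a::comm_semiring_1 mpoly \<Rightarrow> 'a mpoly" where
  "subst G p =
     (\<Sum>m \<in> Poly_Mapping.keys p.
        Const (Poly_Mapping.lookup p m) *
        (\<Prod>i \<in> Poly_Mapping.keys m. G i ^ Poly_Mapping.lookup m i))"

text \<open>
  Linear independence over \<open>k\<close> of the family \<open>L\<^sub>0, \<dots>, L\<^sub>r\<close> (not of the set of its members, so that
  repetitions count as dependent).
\<close>

definition lin_indep_family :: "nat \<Rightarrow> (nat \<Rightarrow> 'a::comm_semiring_1 mpoly) \<Rightarrow> bool" where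
  "lin_indep_family r L \<longleftrightarrow>
     (\<forall>c :: nat \<Rightarrow> 'a. (\<Sum>i\<le>r. Const (c i) * L i) = 0 \<longrightarrow> (\<forall>i\<le>r. c i = 0))"


section \<open>Rational maps between projective spaces of dimension \<open>n\<close>\<close>

text \<open>
  A rational map is represented by a tuple \<open>(G\<^sub>0, \<dots>, G\<^sub>n)\<close> of forms of the same degree, not all
  zero; entries with index above \<open>n\<close> are irrelevant. Two tuples represent the same rational map iff
  they are proportional over \<open>k(X\<^sub>0, \<dots>, X\<^sub>n)\<close>.
\<close>

definition rat_map :: "nat \<Rightarrow> (nat \<Rightarrow> 'a::zero mpoly) \<Rightarrow> bool" where
  "rat_map n G \<longleftrightarrow> (\<exists>d. \<forall>i\<le>n. homogeneous n d (G i)) \<and> (\<exists>i\<le>n. G i \<noteq> 0)"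

definition same_rat_map :: "nat \<Rightarrow> (nat \<Rightarrow> 'a::comm_semiring_1 mpoly) \<Rightarrow> (nat \<Rightarrow> 'a mpoly) \<Rightarrow> bool" where
  "same_rat_map n G H \<longleftrightarrow>
     rat_map n G \<and> rat_map n H \<and> (\<forall>i\<le>n. \<forall>j\<le>n. G i * H j = G j * H i)"

text \<open>
  \<open>rat_comp H G\<close> is the map \<open>G\<close> followed by \<open>H\<close>. It represents a rational map only if the resulting
  forms are not all zero, which is part of \<open>same_rat_map\<close>.
\<close>

definition rat_comp :: "(nat \<Rightarrow> 'a::comm_semiring_1 mpoly) \<Rightarrow> (nat \<Rightarrow> 'a mpoly) \<Rightarrow> nat \<Rightarrow> 'a mpoly" where
  "rat_comp H G = (\<lambda>i. subst G (H i))"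

text \<open>The tuple \<open>Var\<close> represents the identity map.\<close>

definition birational :: "nat \<Rightarrow> (nat \<Rightarrow> 'a::comm_semiring_1 mpoly) \<Rightarrow> bool" where
  "birational n G \<longleftrightarrow> rat_map n G \<and>
     (\<exists>H. rat_map n H \<and> same_rat_map n (rat_comp H G) Var \<and> same_rat_map n (rat_comp G H) Var)"


section \<open>Polar maps and homaloidal polynomials\<close>

text \<open>With respect to the dual coordinates on the target.\<close>

definition polar :: "'a::comm_semiring_1 mpoly \<Rightarrow> nat \<Rightarrow> 'a mpoly" where
  "polar F = (\<lambda>i. partial_deriv i F)"

text \<open>
  \<open>M\<close> arises from \<open>G\<close> by dividing all entries by a greatest common divisor \<open>D\<close>. As \<open>D\<close> is unique up
  to a nonzero constant, so is \<open>M\<close> (unless \<open>G\<close> is zero).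
\<close>

definition moving_part :: "nat \<Rightarrow> (nat \<Rightarrow> 'a::comm_semiring_1 mpoly) \<Rightarrow> (nat \<Rightarrow> 'a mpoly) \<Rightarrow> bool" where
  "moving_part n G M \<longleftrightarrow>
     (\<exists>D. (\<forall>i\<le>n. D dvd G i) \<and> (\<forall>E. (\<forall>i\<le>n. E dvd G i) \<longrightarrow> E dvd D) \<and>
          (\<forall>i\<le>n. G i = D * M i))"

definition homaloidal :: "nat \<Rightarrow> 'a::comm_semiring_1 mpoly \<Rightarrow> bool" where
  "homaloidal n F \<longleftrightarrow>
     F \<noteq> 0 \<and> (\<exists>d\<ge>1. homogeneous n d F) \<and> (\<exists>M. moving_part n (polar F) M \<and> birational n M)"


section \<open>Projectivities and standard Cremona transformations\<close>

definition linear_map :: "nat \<Rightarrow> 'a::comm_semiring_1 mat \<Rightarrow> nat \<Rightarrow> 'a mpoly" where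
  "linear_map n A = (\<lambda>i. \<Sum>j\<le>n. Const (A $$ (i, j)) * Var j)"

definition projectivity :: "nat \<Rightarrow> (nat \<Rightarrow> 'a::comm_semiring_1 mpoly) \<Rightarrow> bool" where
  "projectivity n P \<longleftrightarrow>
     (\<exists>A \<in> carrier_mat (Suc n) (Suc n). invertible_mat A \<and> same_rat_map n P (linear_map n A))"

definition cremona_tuple :: "nat \<Rightarrow> nat \<Rightarrow> 'a::comm_semiring_1 mpoly" where
  "cremona_tuple n = (\<lambda>i. \<Prod>j \<in> {..n} - {i}. Var j)"

text \<open>
  The source coordinates are \<open>Y = A X\<close>. The corresponding coordinates on the target are the dual ones:
  a point with coordinates \<open>\<eta>\<close> dual to \<open>Y\<close> has coordinates \<open>A\<^sup>T \<eta>\<close> dual to \<open>X\<close>.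
\<close>

definition standard_cremona :: "nat \<Rightarrow> (nat \<Rightarrow> 'a::comm_semiring_1 mpoly) \<Rightarrow> bool" where
  "standard_cremona n S \<longleftrightarrow>
     (\<exists>A \<in> carrier_mat (Suc n) (Suc n). invertible_mat A \<and>
        same_rat_map n S
          (rat_comp (linear_map n (transpose_mat A)) (rat_comp (cremona_tuple n) (linear_map n A))))"

end

theory Submission
  imports Defs "HOL-Computational_Algebra.Polynomial"
begin

text \<open>
  If a nonzero vector is killed by all \<open>L\<^sub>i\<close>, the partial derivatives of \<open>F\<close> are linearly dependent, so
  the polar map is not dominant. Hence the \<open>L\<^sub>i\<close> span, and if \<open>r = n\<close> they are coordinates. Otherwise
  choose a basis \<open>Y\<^sub>0, \<dots>, Y\<^sub>n\<close> among the \<open>L\<^sub>i\<close> and a further \<open>L\<^sub>s\<close>; as \<open>F\<close> is square-free, we may assume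
  that \<open>Y\<^sub>0\<close> and \<open>Y\<^sub>1\<close> both occur in \<open>L\<^sub>s\<close>. Along the arc \<open>Y = (\<tau>, 1, \<epsilon>\<^bsup>w 2\<^esup>, \<dots>, \<epsilon>\<^bsup>w n\<^esup>)\<close> with rapidly growing
  weights \<open>w\<close> the polar map degenerates to the polar map of the binary form \<open>f\<close> that \<open>F\<close> induces on the
  line \<open>Y\<^sub>2 = \<dots> = Y\<^sub>n = 0\<close>, times Laurent monomials in \<open>\<epsilon>\<close>. Comparing leading coefficients in
  \<open>\<epsilon>\<close>, a rational inverse of the polar map of \<open>F\<close> yields one of the polar map of \<open>f\<close>. But the latter has
  degree one less than the number of zeros of \<open>f\<close> on the line, and these include the distinct zeros of
  \<open>Y\<^sub>0\<close>, \<open>Y\<^sub>1\<close> and \<open>L\<^sub>s\<close>.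
\<close>


section \<open>Binary forms in two univariate polynomials\<close>

definition comax :: "'a::comm_ring_1 \<Rightarrow> 'a \<Rightarrow> bool" where
  "comax a b \<longleftrightarrow> (\<exists>x y. x * a + y * b = 1)"

lemma comax_mult:
  assumes "comax a b" "comax a c"
  shows "comax a (b * c)"
proof -
  obtain x y where 1: "x * a + y * b = 1" using assms by (auto simp: comax_def)
  obtain u v where 2: "u * a + v * c = 1" using assms by (auto simp: comax_def)
  have "(x * a + y * b) * (u * a + v * c) = 1"
    using 1 2 by simp
  then have "(x * u * a + x * v * c + y * b * u) * a + (y * v) * (b * c) = 1"
    by (simp add: algebra_simps)
  then show ?thesis unfolding comax_def by blast
qed

lemma comax_power: "comax a b \<Longrightarrow> comax a (b ^ m)"
proof (induction m)
  case 0
  have "0 * a + 1 * 1 = 1" by simp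
  then show ?case unfolding comax_def by (metis power_0)
qed (simp add: comax_mult)

lemma comax_sym: "comax a b \<longleftrightarrow> comax b a"
  unfolding comax_def by (metis add.commute)

lemma comax_dvd_dvd:
  assumes "comax a b" "c dvd a" "c dvd b"
  shows "c dvd 1"
  using assms unfolding comax_def by (metis dvd_add dvd_mult)

lemma comax_add_multiple:
  assumes "comax a b"
  shows "comax a (b + a * s)"
proof -
  obtain x y where "x * a + y * b = 1" using assms by (auto simp: comax_def)
  then have "(x - y * s) * a + y * (b + a * s) = 1"
    by (simp add: algebra_simps)
  then show ?thesis unfolding comax_def by blast
qed

text \<open>A nonzero element \<open>d\<close> of least degree in the ideal generated by
  \<open>a\<close> and \<open>b\<close> divides the whole ideal, because a nonzero remainder would
  be an element of smaller degree. Cancelling \<open>d\<close> in its own representation leaves the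
  Bezout identity of the cofactors.\<close>

lemma poly_gcd_bezout:
  fixes a b :: "'a::field poly"
  assumes "a \<noteq> 0 \<or> b \<noteq> 0"
  obtains d a' b' where "d \<noteq> 0" "a = d * a'" "b = d * b'" "comax a' b'"
proof -
  define I where "I = {u * a + v * b | u v. u * a + v * b \<noteq> 0}"
  have "1 * a + 0 * b \<noteq> 0 \<or> 0 * a + 1 * b \<noteq> 0" using assms by simp
  then have "I \<noteq> {}" unfolding I_def by blast
  then obtain d where d: "d \<in> I" and min: "\<And>e. e \<in> I \<Longrightarrow> degree d \<le> degree e"
    using ex_has_least_nat[of "\<lambda>x. x \<in> I" _ degree] by blast
  obtain u v where duv: "d = u * a + v * b" and d0: "d \<noteq> 0"
    using d by (auto simp: I_def)
  have dvd: "d dvd x" if "x = s * a + t * b" for x s t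
  proof (rule ccontr)
    assume "\<not> d dvd x"
    then have r0: "x mod d \<noteq> 0" by (simp add: dvd_eq_mod_eq_0)
    have "x mod d = x - (x div d) * d" by (simp add: minus_div_mult_eq_mod)
    also have "\<dots> = (s - (x div d) * u) * a + (t - (x div d) * v) * b"
      unfolding duv that by (simp add: algebra_simps)
    finally have "\<exists>u v. x mod d = u * a + v * b" by blast
    with r0 have "x mod d \<in> I" unfolding I_def mem_Collect_eq by metis
    then have "degree d \<le> degree (x mod d)" by (rule min)
    moreover have "degree (x mod d) < degree d"
      using degree_mod_less[OF d0] r0 by blast
    ultimately show False by simp
  qed
  have "d dvd a" by (rule dvd[of _ 1 0]) simp
  moreover have "d dvd b" by (rule dvd[of _ 0 1]) simp
  ultimately obtain a' b' where ab: "a = d * a'" "b = d * b'" by (auto elim!: dvdE)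
  have "d * (u * a' + v * b') = u * (d * a') + v * (d * b')" by (simp add: algebra_simps)
  also have "\<dots> = u * a + v * b" by (simp only: ab)
  also have "\<dots> = d * 1" using duv by simp
  finally have "d * (u * a' + v * b') = d * 1" .
  then have "u * a' + v * b' = 1" using d0 by (simp only: mult_cancel_left) simp
  then have "comax a' b'" unfolding comax_def by blast
  with that d0 ab show thesis by blast
qed

text \<open>The binary form \<open>q\<^sup>k c(p / q)\<close>, for \<open>degree c \<le> k\<close>.\<close>

definition binform :: "nat \<Rightarrow> 'a::comm_ring_1 poly \<Rightarrow> 'a poly \<Rightarrow> 'a poly \<Rightarrow> 'a poly" where
  "binform k c p q = (\<Sum>i\<le>k. smult (coeff c i) (p ^ i * q ^ (k - i)))"

lemma binform_0: "binform 0 c p q = [:coeff c 0:]"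
  by (simp add: binform_def)

text \<open>Horner's rule in homogenised form, on which the inductions over the formal degree
  rest.\<close>

lemma binform_pCons:
  "binform (Suc k) (pCons a c) p q = smult a (q ^ Suc k) + p * binform k c p q"
  unfolding binform_def
  by (subst sum.atMost_Suc_shift) (simp add: sum_distrib_left algebra_simps del: sum.atMost_Suc)

lemma binform_add: "binform k (c + d) p q = binform k c p q + binform k d p q"
  by (simp add: binform_def smult_add_left sum.distrib)

lemma binform_smult: "binform k (smult a c) p q = smult a (binform k c p q)"
proof -
  have "binform k (smult a c) p q = (\<Sum>i\<le>k. [:a:] * smult (coeff c i) (p ^ i * q ^ (k - i)))"
    unfolding binform_def by (simp add: mult.commute)
  also have "\<dots> = smult a (binform k c p q)"
    unfolding binform_def sum_distrib_left[symmetric] by simp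
  finally show ?thesis .
qed

text \<open>Each unit of formal degree beyond \<open>k\<close> adds a zero at infinity, that is, a
  factor \<open>q\<close>.\<close>

lemma binform_raise:
  "degree c \<le> k \<Longrightarrow> binform (j + k) c p q = q ^ j * binform k c p q"
proof -
  assume "degree c \<le> k"
  have "binform (j + k) c p q = (\<Sum>i\<le>k. smult (coeff c i) (p ^ i * q ^ (j + k - i)))"
    unfolding binform_def using \<open>degree c \<le> k\<close>
    by (intro sum.mono_neutral_right) (auto simp: coeff_eq_0)
  also have "\<dots> = q ^ j * binform k c p q"
    unfolding binform_def sum_distrib_left
    by (intro sum.cong refl) (auto simp: algebra_simps simp flip: power_add)
  finally show ?thesis .
qed

text \<open>Formal degrees add even where leading coefficients vanish, so homogenisation to formal
  degrees is multiplicative. The induction peels off the constant coefficient of \<open>c\<close> by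
  Horner's rule.\<close>

lemma binform_mult:
  assumes "degree c \<le> k" "degree d \<le> l"
  shows "binform (k + l) (c * d) p q = binform k c p q * binform l d p q"
  using assms(1)
proof (induction k arbitrary: c)
  case 0
  then obtain a where c: "c = [:a:]" by (metis degree_0_id le_zero_eq)
  then show ?case by (simp add: binform_0 binform_smult)
next
  case (Suc k)
  obtain a c' where c: "c = pCons a c'" by (cases c) auto
  then have deg: "degree c' \<le> k" using Suc.prems by (auto split: if_splits)
  have "binform (Suc k + l) (c * d) p q =
        binform (Suc k + l) (smult a d) p q + binform (Suc k + l) (pCons 0 (c' * d)) p q"
    by (simp add: c binform_add)
  also have "binform (Suc k + l) (smult a d) p q = smult a (q ^ Suc k * binform l d p q)"
    by (simp only: binform_smult binform_raise[OF assms(2)])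
  also have "binform (Suc k + l) (pCons 0 (c' * d)) p q = p * (binform k c' p q * binform l d p q)"
    by (simp add: binform_pCons Suc.IH[OF deg])
  finally show ?case by (simp add: c binform_pCons algebra_simps)
qed

lemma binform_scale: "binform k c (g * p) (g * q) = g ^ k * binform k c p q"
  unfolding binform_def sum_distrib_left
proof (intro sum.cong refl)
  fix i assume "i \<in> {..k}"
  then have "g ^ i * g ^ (k - i) = g ^ k" by (simp flip: power_add)
  then show "smult (coeff c i) ((g * p) ^ i * (g * q) ^ (k - i)) =
      g ^ k * smult (coeff c i) (p ^ i * q ^ (k - i))"
    by (simp add: power_mult_distrib mult_ac flip: \<open>g ^ i * g ^ (k - i) = g ^ k\<close>)
qed

lemma binform_degree_le:
  assumes "degree p \<le> degree q"
  shows "degree (binform k c p q) \<le> k * degree q"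
  unfolding binform_def
proof (rule degree_sum_le)
  fix i assume i: "i \<in> {..k}"
  have "degree (smult (coeff c i) (p ^ i * q ^ (k - i))) \<le> degree (p ^ i * q ^ (k - i))"
    by (rule degree_smult_le)
  also have "\<dots> \<le> degree (p ^ i) + degree (q ^ (k - i))" by (rule degree_mult_le)
  also have "\<dots> \<le> degree p * i + degree q * (k - i)"
    by (intro add_mono degree_power_le)
  also have "\<dots> \<le> degree q * i + degree q * (k - i)" using assms by simp
  also have "\<dots> = k * degree q" using i by (simp flip: distrib_left)
  finally show "degree (smult (coeff c i) (p ^ i * q ^ (k - i))) \<le> k * degree q" .
qed simp

text \<open>As \<open>q\<close> has the larger degree, the one term without a factor
  \<open>p\<close> dominates all others.\<close>

lemma binform_degree:
  fixes p q :: "'a::field poly"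
  assumes "degree p < degree q" "coeff c 0 \<noteq> 0"
  shows "degree (binform k c p q) = k * degree q"
proof (cases k)
  case 0
  then show ?thesis by (simp add: binform_0)
next
  case (Suc l)
  obtain a d where c: "c = pCons a d" by (cases c) auto
  have "degree (p * binform l d p q) \<le> degree p + l * degree q"
    using degree_mult_le[of p "binform l d p q"] binform_degree_le[of p q l d] assms by simp
  also have "\<dots> < k * degree q" using assms Suc by simp
  also have "k * degree q = degree (smult a (q ^ k))"
    using assms c by (subst degree_smult_eq, subst degree_power_eq) auto
  finally show ?thesis
    unfolding Suc c binform_pCons
    using \<open>k * degree q = degree (smult a (q ^ k))\<close> by (simp add: degree_add_eq_left Suc)
qed

text \<open>Vanishing low coefficients only split off factors \<open>p\<close>; at the first nonzero
  one the degree is known and positive unless the form is a constant.\<close>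

lemma binform_nonzero:
  fixes p q :: "'a::field poly"
  assumes "degree p < degree q" "p \<noteq> 0" "c \<noteq> 0" "degree c \<le> k"
  shows "binform k c p q \<noteq> 0"
  using assms(3,4)
proof (induction k arbitrary: c)
  case 0
  then show ?case by (metis binform_0 degree_0_id le_zero_eq)
next
  case (Suc k)
  obtain a d where c: "c = pCons a d" by (cases c) auto
  show ?case
  proof (cases "a = 0")
    case True
    with Suc c have "binform k d p q \<noteq> 0" by (intro Suc.IH) auto
    with True c assms(2) show ?thesis by (simp add: binform_pCons)
  next
    case False
    then have "degree (binform (Suc k) c p q) = Suc k * degree q"
      using assms(1) c by (intro binform_degree) auto
    with assms(1) show ?thesis by auto
  qed
qed

text \<open>
  A rational function \<open>p / q\<close> of degree \<open>d\<close> composed with one of degree \<open>k\<close> has degree \<open>d * k\<close>, so it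
  has no left inverse unless \<open>d = 1\<close>.
\<close>

lemma no_rational_left_inverse:
  fixes p q :: "'a::field poly"
  assumes pq: "comax p q" and deg: "degree p < degree q" "degree q \<ge> 2" and p0: "p \<noteq> 0"
    and c: "c0 \<noteq> 0" "c1 \<noteq> 0" "degree c0 \<le> K" "degree c1 \<le> K"
  shows "binform K c0 p q \<noteq> [:0, 1:] * binform K c1 p q"
proof
  assume eq: "binform K c0 p q = [:0, 1:] * binform K c1 p q"
  \<comment> \<open>Reduce the fraction \<open>c0 / c1\<close> to lowest terms
    \<open>a / b\<close>.\<close>
  obtain d a b where d0: "d \<noteq> 0" and cd: "c0 = d * a" "c1 = d * b" and ab: "comax a b"
    using poly_gcd_bezout[of c0 c1] c by metis
  have a0: "a \<noteq> 0" and b0: "b \<noteq> 0" using c cd by auto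
  define k where "k = max (degree a) (degree b)"
  have dk: "degree a \<le> k" "degree b \<le> k" by (auto simp: k_def)
  have "degree d + k \<le> K"
    using c cd d0 a0 b0 by (auto simp: k_def degree_mult_eq max_def)
  \<comment> \<open>The formal degree \<open>K - k\<close> is what remains for the common factor
    \<open>d\<close>; its form is nonzero and can be cancelled.\<close>
  then have dd: "degree d \<le> K - k" and Kk: "K - k + k = K" by auto
  have bf: "binform K c0 p q = binform (K - k) d p q * binform k a p q"
    "binform K c1 p q = binform (K - k) d p q * binform k b p q"
    using binform_mult[OF dd dk(1)] binform_mult[OF dd dk(2)] Kk cd by auto
  have "binform (K - k) d p q \<noteq> 0" by (rule binform_nonzero[OF deg(1) p0 d0 dd])
  moreover have "binform (K - k) d p q * binform k a p q =
      binform (K - k) d p q * ([:0, 1:] * binform k b p q)"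
    using eq bf by (simp only: ac_simps)
  ultimately have E: "binform k a p q = [:0, 1:] * binform k b p q"
    by (simp only: mult_cancel_left) simp
  have bb0: "binform k b p q \<noteq> 0" by (rule binform_nonzero[OF deg(1) p0 b0 dk(2)])
  have dE: "degree (binform k a p q) = Suc (degree (binform k b p q))"
    unfolding E using bb0 by (simp add: degree_mult_eq)
  \<comment> \<open>If \<open>a\<close> vanishes at 0, then \<open>b\<close> does not, and the right
    side of \<open>E\<close> would have degree \<open>k * degree q + 1\<close>, above the bound for
    the left side. So only the second case can occur.\<close>
  have db: "degree (binform k b p q) + 1 = k * degree q"
  proof (cases "coeff a 0 = 0")
    case True
    obtain u v where uv: "u * a + v * b = 1" using ab by (auto simp: comax_def)
    have "coeff (u * a + v * b) 0 = 1" by (simp add: uv)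
    with True have "coeff b 0 \<noteq> 0" by (auto simp: coeff_mult)
    then have "degree (binform k b p q) = k * degree q" by (rule binform_degree[OF deg(1)])
    moreover have "degree (binform k a p q) \<le> k * degree q"
      using deg by (intro binform_degree_le) simp
    ultimately show ?thesis using dE by simp
  next
    case False
    then show ?thesis using binform_degree[OF deg(1) False, of k] dE by simp
  qed
  then have "k \<ge> 1" by (cases k) auto
  then have "k * degree q \<ge> 1 * 2" using deg(2) by (intro mult_mono) auto
  then have pos: "degree (binform k b p q) \<ge> 1" using db by simp
  \<comment> \<open>By \<open>pos\<close>, which rests on \<open>degree q \<ge> 2\<close>, this
    polynomial is not constant. It is now shown to be a unit: homogenising the Bezout identity of
    \<open>a\<close> and \<open>b\<close> makes it divide a power of \<open>q\<close>, and it also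
    divides a form that is comaximal with \<open>q\<close>.\<close>
  define h where "h = binform k b p q"
  obtain u v where uv: "u * a + v * b = 1" using ab by (auto simp: comax_def)
  define m where "m = max (degree u) (degree v)"
  have "binform (m + k) (u * a + v * b) p q = binform m u p q * binform k a p q + binform m v p q * binform k b p q"
    unfolding binform_add using dk by (simp add: binform_mult m_def)
  then have "h dvd binform (m + k) 1 p q"
    unfolding uv E h_def by (metis dvd_add dvd_mult dvd_refl)
  moreover have "binform (m + k) 1 p q = q ^ (m + k)"
    using binform_raise[of 1 0 "m + k" p q] by (simp add: binform_0)
  ultimately have hq: "h dvd q ^ (m + k)" by simp
  \<comment> \<open>Whichever of \<open>a\<close> and \<open>b\<close> attains the formal degree
    \<open>k\<close>: modulo \<open>q\<close> its form is a nonzero constant times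
    \<open>p ^ k\<close>.\<close>
  define x where "x = (if degree a = k then a else b)"
  have "degree x = k" "x \<noteq> 0" using a0 b0 by (auto simp: x_def k_def)
  then have x: "coeff x k \<noteq> 0" by (metis leading_coeff_neq_0)
  have hx: "h dvd binform k x p q"
    using E by (metis x_def h_def dvd_refl dvd_triv_right)
  obtain s where s: "binform k x p q = smult (coeff x k) (p ^ k) + q * s"
  proof -
    obtain l where l: "k = Suc l" using \<open>k \<ge> 1\<close> by (cases k) auto
    have "binform k x p q = (\<Sum>i\<le>l. smult (coeff x i) (p ^ i * q ^ (k - i))) + smult (coeff x k) (p ^ k)"
      by (simp add: binform_def l)
    also have "(\<Sum>i\<le>l. smult (coeff x i) (p ^ i * q ^ (k - i))) =
        q * (\<Sum>i\<le>l. smult (coeff x i) (p ^ i * q ^ (l - i)))"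
      unfolding sum_distrib_left by (intro sum.cong refl) (auto simp: l Suc_diff_le algebra_simps)
    finally show ?thesis by (metis that add.commute)
  qed
  have "comax q (p ^ k)" using pq comax_power comax_sym by blast
  then have "comax q (smult (coeff x k) (p ^ k))"
  proof -
    assume "comax q (p ^ k)"
    then obtain y z where "y * q + z * p ^ k = 1" by (auto simp: comax_def)
    then have "y * q + smult (inverse (coeff x k)) z * smult (coeff x k) (p ^ k) = 1"
      using x by simp
    then show ?thesis unfolding comax_def by blast
  qed
  then have "comax q (binform k x p q)" unfolding s by (rule comax_add_multiple)
  then have "comax (binform k x p q) (q ^ (m + k))" using comax_power comax_sym by blast
  then have "h dvd 1" using hx hq by (rule comax_dvd_dvd)
  with bb0 have "degree h = 0" by (simp add: h_def is_unit_iff_degree)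
  with pos h_def show False by simp
qed

text \<open>
  Dividing \<open>f'\<close> and \<open>f\<close> by their gcd leaves a fraction whose degree is the number of distinct roots of
  \<open>f\<close>, which is at least two.
\<close>

lemma no_log_derivative_left_inverse:
  fixes f :: "'a::field_char_0 poly"
  assumes f0: "f \<noteq> 0" and N: "degree f < N" and roots: "poly f a = 0" "poly f b = 0" "a \<noteq> b"
    and c: "c0 \<noteq> 0" "c1 \<noteq> 0" "degree c0 \<le> K" "degree c1 \<le> K"
  defines "q \<equiv> of_nat N * f - [:0, 1:] * pderiv f"
  shows "binform K c0 (pderiv f) q \<noteq> [:0, 1:] * binform K c1 (pderiv f) q"
    and "binform K c0 (pderiv f) q \<noteq> 0"
proof -
  have degf: "degree f \<ge> 1"
  proof (rule ccontr)
    assume "\<not> degree f \<ge> 1"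
    then obtain x where "f = [:x:]" by (metis degree_0_id less_one not_le)
    with roots(1) f0 show False by simp
  qed
  then have f'0: "pderiv f \<noteq> 0" by (auto simp: pderiv_eq_0_iff)
  obtain g R p where g0: "g \<noteq> 0" and f: "f = g * R" and f': "pderiv f = g * p" and cm: "comax R p"
    using poly_gcd_bezout[of f "pderiv f"] f0 by metis
  \<comment> \<open>By Euler's relation \<open>q\<close> is the derivative in the second variable,
    at (x, 1), of the binary form of degree \<open>N\<close> belonging to \<open>f\<close>. Dividing
    \<open>q\<close> by \<open>g\<close> gives \<open>q'\<close>.\<close>
  define q' where "q' = of_nat N * R - [:0, 1:] * p"
  have q: "q = g * q'" unfolding q_def q'_def f' by (simp add: f algebra_simps)
  have R0: "R \<noteq> 0" and p0: "p \<noteq> 0" using f0 f f'0 f' by auto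
  \<comment> \<open>In characteristic zero differentiation lowers the order of a root by exactly
    one, so \<open>R\<close> keeps every root of \<open>f\<close>.\<close>
  have rootR: "poly R x = 0" if "poly f x = 0" for x
  proof -
    have "order x f = Suc (order x (pderiv f))" by (rule order_pderiv[OF f0 that])
    then have "order x g + order x R = Suc (order x g + order x p)"
      using f0 f'0 by (metis f f' order_mult)
    then show ?thesis using R0 by (metis add_left_cancel add_Suc_right order_root nat.distinct(1))
  qed
  have "{a, b} \<subseteq> {x. poly R x = 0}" using rootR roots by auto
  then have "card {a, b} \<le> card {x. poly R x = 0}"
    by (intro card_mono poly_roots_finite R0)
  also have "\<dots> \<le> degree R" by (rule card_poly_roots_bound[OF R0])
  finally have dR: "degree R \<ge> 2" using roots by simp
  have "degree (pderiv f) < degree f" using degf by (simp add: degree_pderiv)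
  then have dpR: "degree p < degree R"
    using f f' g0 R0 p0 by (metis degree_mult_eq add_less_cancel_left)
  \<comment> \<open>The top coefficient is that of \<open>f\<close> times
    \<open>N - degree f\<close>; it survives because the binary form of degree \<open>N\<close> has
    a zero at infinity.\<close>
  have "coeff q (degree f) \<noteq> 0"
  proof -
    obtain D where D: "degree f = Suc D" using degf by (cases "degree f") auto
    have "coeff q (degree f) = (of_nat N - of_nat (degree f)) * lead_coeff f"
      unfolding q_def by (simp add: D coeff_pCons coeff_pderiv algebra_simps of_nat_poly)
    then show ?thesis using N f0 by simp
  qed
  moreover have "degree q \<le> degree f"
  proof -
    have "degree ([:0, 1:] * pderiv f) \<le> degree f"
      using degree_mult_le[of "[:0, 1:]" "pderiv f"] degf by (simp add: degree_pderiv)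
    moreover have "degree (of_nat N * f) \<le> degree f"
      using degree_mult_le[of "of_nat N" f] by simp
    ultimately show ?thesis unfolding q_def by (rule degree_diff_le[rotated])
  qed
  ultimately have "degree q = degree f" by (simp add: le_antisym le_degree)
  moreover have q'0: "q' \<noteq> 0" using \<open>coeff q (degree f) \<noteq> 0\<close> q by auto
  ultimately have dq: "degree q' = degree R" using q f g0 R0 by (simp add: degree_mult_eq)
  \<comment> \<open>Modulo \<open>p\<close>, \<open>q'\<close> is \<open>N\<close> times
    \<open>R\<close>, and \<open>N\<close> is invertible in characteristic zero.\<close>
  have "comax p (of_nat N * R)"
  proof -
    obtain y z where yz: "y * R + z * p = 1" using cm by (auto simp: comax_def)
    have "[:1 / of_nat N:] * of_nat N = (1 :: 'a poly)"
      using N by (simp add: of_nat_poly one_pCons)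
    then have "z * p + ([:1 / of_nat N:] * y) * (of_nat N * R) = 1"
      using yz by (metis add.commute mult.assoc mult.left_commute mult.right_neutral)
    then show ?thesis unfolding comax_def by blast
  qed
  moreover have "of_nat N * R + p * - [:0, 1:] = q'" unfolding q'_def by simp
  ultimately have "comax p q'" using comax_add_multiple by metis
  then have "binform K c0 p q' \<noteq> [:0, 1:] * binform K c1 p q'"
    using dpR dR dq p0 c by (intro no_rational_left_inverse) auto
  then have "g ^ K * binform K c0 p q' \<noteq> g ^ K * ([:0, 1:] * binform K c1 p q')"
    using g0 by (metis mult_left_cancel power_not_zero)
  then show "binform K c0 (pderiv f) q \<noteq> [:0, 1:] * binform K c1 (pderiv f) q"
    unfolding f' q binform_scale by (simp only: ac_simps) simp
  have "binform K c0 p q' \<noteq> 0"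
    using dpR dq p0 c by (intro binform_nonzero) auto
  then show "binform K c0 (pderiv f) q \<noteq> 0"
    unfolding f' q binform_scale using g0 by simp
qed


section \<open>Evaluation, homogeneity and derivatives of multivariate polynomials\<close>

definition mon_ev :: "(nat \<Rightarrow> 'b) \<Rightarrow> (nat \<Rightarrow>\<^sub>0 nat) \<Rightarrow> 'b::comm_semiring_1" where
  "mon_ev x m = (\<Prod>i \<in> Poly_Mapping.keys m. x i ^ Poly_Mapping.lookup m i)"

text \<open>The map \<open>\<phi>\<close> on coefficients lets one notion cover both
  \<open>subst\<close>, where it is \<open>Const\<close>, and evaluation at points of an arc with
  coordinates in \<open>'k poly poly\<close>.\<close>

definition ev :: "('a::zero \<Rightarrow> 'b) \<Rightarrow> (nat \<Rightarrow> 'b) \<Rightarrow> 'a mpoly \<Rightarrow> 'b::comm_semiring_1" where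
  "ev \<phi> x p = (\<Sum>m \<in> Poly_Mapping.keys p. \<phi> (Poly_Mapping.lookup p m) * mon_ev x m)"

lemma subst_eq_ev: "subst G = ev Const G"
  by (simp add: fun_eq_iff subst_def ev_def mon_ev_def)

lemma mon_ev_superset:
  assumes "finite S" "Poly_Mapping.keys m \<subseteq> S"
  shows "mon_ev x m = (\<Prod>i \<in> S. x i ^ Poly_Mapping.lookup m i)"
  unfolding mon_ev_def using assms
  by (intro prod.mono_neutral_left) (auto simp: in_keys_iff)

lemma mon_ev_add: "mon_ev x (m + m') = mon_ev x m * mon_ev x m'"
proof -
  let ?S = "Poly_Mapping.keys m \<union> Poly_Mapping.keys m'"
  have "mon_ev x (m + m') = (\<Prod>i \<in> ?S. x i ^ Poly_Mapping.lookup (m + m') i)"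
    by (rule mon_ev_superset) (auto simp: keys_add)
  also have "\<dots> = (\<Prod>i \<in> ?S. x i ^ Poly_Mapping.lookup m i) * (\<Prod>i \<in> ?S. x i ^ Poly_Mapping.lookup m' i)"
    by (simp add: lookup_add power_add prod.distrib)
  also have "\<dots> = mon_ev x m * mon_ev x m'"
    by (simp add: mon_ev_superset[of ?S])
  finally show ?thesis .
qed

lemma mon_ev_0 [simp]: "mon_ev x 0 = 1"
  by (simp add: mon_ev_def)

lemma mpoly_sum_singles:
  "(p :: 'a::comm_monoid_add mpoly) = (\<Sum>m \<in> Poly_Mapping.keys p. Poly_Mapping.single m (Poly_Mapping.lookup p m))"
proof (rule poly_mapping_eqI)
  fix m
  have "Poly_Mapping.lookup (\<Sum>m \<in> Poly_Mapping.keys p. Poly_Mapping.single m (Poly_Mapping.lookup p m)) m =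
      (\<Sum>m' \<in> Poly_Mapping.keys p. if m' = m then Poly_Mapping.lookup p m' else 0)"
    unfolding lookup_sum by (intro sum.cong) (auto simp: lookup_single when_def)
  also have "\<dots> = Poly_Mapping.lookup p m" by (simp add: in_keys_iff)
  finally show "Poly_Mapping.lookup p m = Poly_Mapping.lookup (\<Sum>m \<in> Poly_Mapping.keys p. Poly_Mapping.single m (Poly_Mapping.lookup p m)) m" ..
qed

text \<open>Polynomials are finite sums of single terms. Applied once in each factor, this reduces
  bilinear identities such as the product rule to single terms.\<close>

lemma mpoly_additive_ext:
  assumes "\<And>p q. h (p + q) = h p + h q" "\<And>p q. h' (p + q) = h' p + h' q" "h 0 = 0" "h' 0 = 0"
    and "\<And>m c. h (Poly_Mapping.single m c) = h' (Poly_Mapping.single m c)"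
  shows "h p = (h' (p :: 'a::comm_monoid_add mpoly) :: 'b::comm_monoid_add)"
proof -
  have sum: "h (sum f A) = (\<Sum>a\<in>A. h (f a))" "h' (sum f A) = (\<Sum>a\<in>A. h' (f a))" if "finite A"
    for f :: "(nat \<Rightarrow>\<^sub>0 nat) \<Rightarrow> 'a mpoly" and A
    using that by (induction A) (simp_all add: assms)
  show ?thesis
    by (subst (1 2) mpoly_sum_singles) (simp add: sum assms)
qed

context comm_ring_hom
begin

lemma ev_superset:
  assumes "finite S" "Poly_Mapping.keys p \<subseteq> S"
  shows "ev hom x p = (\<Sum>m \<in> S. hom (Poly_Mapping.lookup p m) * mon_ev x m)"
  unfolding ev_def using assms
  by (intro sum.mono_neutral_left) (auto simp: in_keys_iff)

lemma ev_add: "ev hom x (p + q) = ev hom x p + ev hom x q"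
proof -
  let ?S = "Poly_Mapping.keys p \<union> Poly_Mapping.keys q"
  have "ev hom x (p + q) = (\<Sum>m \<in> ?S. hom (Poly_Mapping.lookup (p + q) m) * mon_ev x m)"
    by (rule ev_superset) (auto simp: keys_add)
  also have "\<dots> = ev hom x p + ev hom x q"
    by (simp add: ev_superset[of ?S] lookup_add hom_add distrib_right sum.distrib)
  finally show ?thesis .
qed

lemma ev_0 [simp]: "ev hom x 0 = 0"
  by (simp add: ev_def)

lemma ev_single: "ev hom x (Poly_Mapping.single m c) = hom c * mon_ev x m"
  by (cases "c = 0") (simp_all add: ev_def)

lemma ev_mult: "ev hom x (p * q) = ev hom x p * ev hom x q"
proof -
  have 1: "ev hom x (Poly_Mapping.single m c * q) = hom c * mon_ev x m * ev hom x q" for m c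
    by (rule mpoly_additive_ext[of "\<lambda>q. ev hom x (Poly_Mapping.single m c * q)"])
      (simp_all add: ev_add distrib_left mult_single ev_single mon_ev_add hom_mult mult.assoc mult.left_commute)
  show ?thesis
    by (rule mpoly_additive_ext[of "\<lambda>p. ev hom x (p * q)"])
      (simp_all add: ev_add distrib_right ev_single 1)
qed

lemma ev_Const [simp]: "ev hom x (Const c) = hom c"
  by (simp add: Const_def ev_single)

lemma ev_Var [simp]: "ev hom x (Var i) = x i"
  by (simp add: Var_def ev_single mon_ev_def)

lemma comm_ring_hom_ev: "comm_ring_hom (ev hom x)"
proof
  show "ev hom x 1 = 1"
    using ev_single[of x 0 1] by simp
qed (simp_all add: ev_add ev_mult)

lemma ev_comp: "comm_ring_hom \<psi> \<Longrightarrow> hom (ev \<psi> x p) = ev (\<lambda>c. hom (\<psi> c)) (\<lambda>i. hom (x i)) p"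
  by (simp add: ev_def mon_ev_def hom_sum hom_mult hom_prod hom_power)

end

lemma comm_ring_hom_Const: "comm_ring_hom (Const :: 'a::comm_ring_1 \<Rightarrow> 'a mpoly)"
  by unfold_locales (simp_all add: Const_def single_add mult_single)

interpretation Const: comm_ring_hom "Const :: 'a::comm_ring_1 \<Rightarrow> 'a mpoly"
  by (rule comm_ring_hom_Const)

lemma Const_eq_0_iff [simp]: "Const c = 0 \<longleftrightarrow> c = 0"
  by (metis Const_def lookup_single_eq single_zero lookup_zero)

lemma (in comm_ring_hom) ev_subst:
  "ev hom x (subst G p) = ev hom (\<lambda>i. ev hom x (G i)) p"
proof -
  interpret E: comm_ring_hom "ev hom x" by (rule comm_ring_hom_ev)
  show ?thesis unfolding subst_eq_ev by (simp add: E.ev_comp comm_ring_hom_Const)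
qed

lemma ev_cong_keys:
  assumes "\<And>m i. m \<in> Poly_Mapping.keys p \<Longrightarrow> i \<in> Poly_Mapping.keys m \<Longrightarrow> x i = y i"
  shows "ev \<phi> x p = ev \<phi> y p"
  unfolding ev_def mon_ev_def using assms by (intro sum.cong refl arg_cong2[of _ _ _ _ "(*)"] prod.cong) auto

section \<open>Homogeneous polynomials under evaluation and ring operations\<close>

lemma homogeneousD:
  assumes "homogeneous n d p" "m \<in> Poly_Mapping.keys p"
  shows "Poly_Mapping.keys m \<subseteq> {..n}" "(\<Sum>i\<le>n. Poly_Mapping.lookup m i) = d"
  using assms by (auto simp: homogeneous_def)

lemma ev_homogeneous:
  assumes "homogeneous n d p"
  shows "ev \<phi> x p = (\<Sum>m \<in> Poly_Mapping.keys p. \<phi> (Poly_Mapping.lookup p m) * (\<Prod>i\<le>n. x i ^ Poly_Mapping.lookup m i))"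
  unfolding ev_def using homogeneousD[OF assms]
  by (intro sum.cong refl arg_cong2[of _ _ _ _ "(*)"] mon_ev_superset) auto

lemma ev_homogeneous_cong:
  assumes "homogeneous n d p" "\<And>i. i \<le> n \<Longrightarrow> x i = y i"
  shows "ev \<phi> x p = ev \<phi> y p"
  using assms(2) homogeneousD(1)[OF assms(1)] by (intro ev_cong_keys) blast

lemma ev_homogeneous_scale:
  assumes "homogeneous n d p"
  shows "ev \<phi> (\<lambda>i. c * x i) p = c ^ d * ev \<phi> x p"
proof -
  have "(\<Prod>i\<le>n. (c * x i) ^ Poly_Mapping.lookup m i) = c ^ d * (\<Prod>i\<le>n. x i ^ Poly_Mapping.lookup m i)"
    if "m \<in> Poly_Mapping.keys p" for m
    using homogeneousD(2)[OF assms that]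
    by (simp add: power_mult_distrib prod.distrib flip: power_sum)
  then show ?thesis
    unfolding ev_homogeneous[OF assms] sum_distrib_left
    by (intro sum.cong refl) (simp add: mult_ac)
qed

lemma homogeneous_0 [simp]: "homogeneous n d 0"
  by (simp add: homogeneous_def)

lemma homogeneous_add:
  "homogeneous n d p \<Longrightarrow> homogeneous n d q \<Longrightarrow> homogeneous n d (p + q)"
  using keys_add[of p q] by (auto simp: homogeneous_def)

lemma homogeneous_sum:
  "(\<And>i. i \<in> A \<Longrightarrow> homogeneous n d (p i)) \<Longrightarrow> homogeneous n d (sum p A)"
  by (induction A rule: infinite_finite_induct) (auto intro: homogeneous_add)

lemma homogeneous_mult:
  fixes p q :: "'a::comm_ring_1 mpoly"
  assumes "homogeneous n d p" "homogeneous n e q"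
  shows "homogeneous n (d + e) (p * q)"
  unfolding homogeneous_def
proof
  fix m assume "m \<in> Poly_Mapping.keys (p * q)"
  then obtain a b where "m = a + b" "a \<in> Poly_Mapping.keys p" "b \<in> Poly_Mapping.keys q"
    using keys_mult[of p q] by auto
  then show "Poly_Mapping.keys m \<subseteq> {..n} \<and> (\<Sum>i\<le>n. Poly_Mapping.lookup m i) = d + e"
    using homogeneousD[OF assms(1), of a] homogeneousD[OF assms(2), of b] keys_add[of a b]
    by (simp add: lookup_add sum.distrib) blast
qed

lemma homogeneous_Const: "homogeneous n 0 (Const c)"
  by (auto simp: homogeneous_def Const_def)

lemma homogeneous_Var: "i \<le> n \<Longrightarrow> linear_form n (Var i :: 'a::comm_ring_1 mpoly)"
  by (auto simp: homogeneous_def Var_def lookup_single when_def)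

lemma homogeneous_prod:
  fixes p :: "'b \<Rightarrow> 'a::comm_ring_1 mpoly"
  shows "(\<And>i. i \<in> A \<Longrightarrow> homogeneous n (d i) (p i)) \<Longrightarrow> homogeneous n (sum d A) (prod p A)"
proof (induction A rule: infinite_finite_induct)
  case (insert x F)
  then show ?case by (auto intro: homogeneous_mult)
qed (use homogeneous_Const[of n "1 :: 'a"] in auto)

lemma homogeneous_power:
  fixes p :: "'a::comm_ring_1 mpoly"
  shows "homogeneous n d p \<Longrightarrow> homogeneous n (d * k) (p ^ k)"
  using homogeneous_prod[of "{..<k}" n "\<lambda>_. d" "\<lambda>_. p"] by (simp add: mult.commute)

lemma homogeneous_subst:
  fixes p :: "'a::comm_ring_1 mpoly"
  assumes "homogeneous n d p" "\<And>i. i \<le> n \<Longrightarrow> homogeneous n e (G i)"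
  shows "homogeneous n (e * d) (subst G p)"
  unfolding subst_eq_ev ev_homogeneous[OF assms(1)]
proof (rule homogeneous_sum)
  fix m assume "m \<in> Poly_Mapping.keys p"
  then have "(\<Sum>i\<le>n. e * Poly_Mapping.lookup m i) = e * d"
    using homogeneousD(2)[OF assms(1)] by (simp flip: sum_distrib_left)
  moreover have "homogeneous n (\<Sum>i\<le>n. e * Poly_Mapping.lookup m i) (\<Prod>i\<le>n. G i ^ Poly_Mapping.lookup m i)"
    using assms(2) by (intro homogeneous_prod homogeneous_power) auto
  ultimately show "homogeneous n (e * d) (Const (Poly_Mapping.lookup p m) * (\<Prod>i\<le>n. G i ^ Poly_Mapping.lookup m i))"
    using homogeneous_mult[OF homogeneous_Const] by fastforce
qed

text \<open>Natural exponents with sum 1 are those of a single variable.\<close>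

lemma linear_form_expand:
  fixes p :: "'a::comm_ring_1 mpoly"
  assumes "linear_form n p"
  shows "p = (\<Sum>j\<le>n. Const (Poly_Mapping.lookup p (Poly_Mapping.single j 1)) * Var j)"
proof (rule poly_mapping_eqI)
  fix m
  have R: "Poly_Mapping.lookup (\<Sum>j\<le>n. Const (Poly_Mapping.lookup p (Poly_Mapping.single j 1)) * Var j) m =
      (\<Sum>j\<le>n. if Poly_Mapping.single j 1 = m then Poly_Mapping.lookup p m else 0)" (is "?R = _")
    unfolding lookup_sum Const_def Var_def mult_single
    by (intro sum.cong refl) (auto simp: lookup_single when_def)
  show "Poly_Mapping.lookup p m = ?R"
  proof (cases "\<exists>j\<le>n. m = Poly_Mapping.single j 1")
    case True
    then obtain j where j: "j \<le> n" "m = Poly_Mapping.single j 1" by blast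
    have E: "Poly_Mapping.single i (1::nat) = m \<longleftrightarrow> i = j" for i
    proof
      assume "Poly_Mapping.single i (1::nat) = m"
      then have "Poly_Mapping.lookup (Poly_Mapping.single i (1::nat)) i = Poly_Mapping.lookup m i" by simp
      then show "i = j" by (simp add: j(2) lookup_single when_def split: if_splits)
    qed (simp add: j(2))
    show ?thesis unfolding R E using j(1) by simp
  next
    case False
    then have "?R = 0" unfolding R by (intro sum.neutral) auto
    moreover have "m \<notin> Poly_Mapping.keys p"
    proof
      assume m: "m \<in> Poly_Mapping.keys p"
      have keys: "Poly_Mapping.keys m \<subseteq> {..n}" and s: "(\<Sum>i\<le>n. Poly_Mapping.lookup m i) = 1"
        using homogeneousD[OF assms m] by auto
      then obtain j where j: "j \<le> n" "Poly_Mapping.lookup m j \<noteq> 0"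
        by (metis (no_types, lifting) atMost_iff sum.neutral zero_neq_one)
      have "Poly_Mapping.lookup m j + (\<Sum>i\<in>{..n} - {j}. Poly_Mapping.lookup m i) = 1"
        using s j by (subst (asm) sum.remove[of _ j]) auto
      then have 1: "Poly_Mapping.lookup m j = 1" "\<forall>i\<in>{..n} - {j}. Poly_Mapping.lookup m i = 0"
        using j(2) by (auto simp: add_is_1)
      have "m = Poly_Mapping.single j 1"
      proof (rule poly_mapping_eqI)
        fix i
        have "i \<notin> Poly_Mapping.keys m" if "\<not> i \<le> n" using keys that by auto
        then have "Poly_Mapping.lookup m i = 0" if "i \<noteq> j"
          using that 1(2) by (cases "i \<le> n") (simp_all add: in_keys_iff)
        then show "Poly_Mapping.lookup m i = Poly_Mapping.lookup (Poly_Mapping.single j 1) i"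
          using 1(1) by (cases "i = j") (simp_all add: lookup_single)
      qed
      with False j show False by blast
    qed
    ultimately show ?thesis by (simp add: in_keys_iff)
  qed
qed

section \<open>Partial derivatives and the product rule\<close>

lemma partial_deriv_superset:
  assumes "finite S" "Poly_Mapping.keys p \<subseteq> S"
  shows "partial_deriv i p = (\<Sum>m \<in> S. Poly_Mapping.single (m - Poly_Mapping.single i 1)
     (Poly_Mapping.lookup p m * of_nat (Poly_Mapping.lookup m i)))"
  unfolding partial_deriv_def using assms
  by (intro sum.mono_neutral_left) (auto simp: in_keys_iff)

lemma partial_deriv_0 [simp]: "partial_deriv i 0 = 0"
  by (simp add: partial_deriv_def)

lemma partial_deriv_add: "partial_deriv i (p + q) = partial_deriv i p + partial_deriv i q"
proof -
  let ?S = "Poly_Mapping.keys p \<union> Poly_Mapping.keys q"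
  have "partial_deriv i (p + q) = (\<Sum>m \<in> ?S. Poly_Mapping.single (m - Poly_Mapping.single i 1)
     (Poly_Mapping.lookup (p + q) m * of_nat (Poly_Mapping.lookup m i)))"
    by (rule partial_deriv_superset) (auto simp: keys_add)
  also have "\<dots> = partial_deriv i p + partial_deriv i q"
    by (simp add: partial_deriv_superset[of ?S] lookup_add distrib_right single_add sum.distrib)
  finally show ?thesis .
qed

lemma partial_deriv_single:
  "partial_deriv i (Poly_Mapping.single m c) =
    Poly_Mapping.single (m - Poly_Mapping.single i 1) (c * of_nat (Poly_Mapping.lookup m i))"
  by (cases "c = 0") (simp_all add: partial_deriv_def)

lemma partial_deriv_mult:
  fixes p q :: "'a::comm_ring_1 mpoly"
  shows "partial_deriv i (p * q) = partial_deriv i p * q + p * partial_deriv i q"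
proof -
  \<comment> \<open>Truncated subtraction commutes with adding \<open>m'\<close> only if the
    variable occurs in \<open>m\<close>; otherwise the coefficient of the term concerned is
    zero.\<close>
  have shift: "m + m' - Poly_Mapping.single i 1 = (m - Poly_Mapping.single i 1) + m'"
    if "Poly_Mapping.lookup m i \<noteq> 0" for m m' :: "nat \<Rightarrow>\<^sub>0 nat"
    using that by (intro poly_mapping_eqI) (auto simp: lookup_add lookup_minus lookup_single when_def)
  have ss: "partial_deriv i (Poly_Mapping.single m c * Poly_Mapping.single m' c') =
      partial_deriv i (Poly_Mapping.single m c) * Poly_Mapping.single m' c' +
      Poly_Mapping.single m c * partial_deriv i (Poly_Mapping.single m' c')"
    for m m' and c c' :: 'a
  proof -
    let ?e = "Poly_Mapping.single i (1::nat)"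
    have 1: "Poly_Mapping.single (m + m' - ?e) (c * c' * of_nat (Poly_Mapping.lookup m i)) =
        Poly_Mapping.single (m - ?e + m') (c * of_nat (Poly_Mapping.lookup m i) * c')"
      using shift[of m m'] by (cases "Poly_Mapping.lookup m i = 0") (simp_all add: mult_ac)
    have 2: "Poly_Mapping.single (m + m' - ?e) (c * c' * of_nat (Poly_Mapping.lookup m' i)) =
        Poly_Mapping.single (m + (m' - ?e)) (c * (c' * of_nat (Poly_Mapping.lookup m' i)))"
      using shift[of m' m] by (cases "Poly_Mapping.lookup m' i = 0") (simp_all add: mult_ac add_ac)
    show ?thesis
      unfolding partial_deriv_single mult_single lookup_add of_nat_add distrib_left single_add 1 2 ..
  qed
  have 1: "partial_deriv i (Poly_Mapping.single m c * q) =
      partial_deriv i (Poly_Mapping.single m c) * q + Poly_Mapping.single m c * partial_deriv i q" for m c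
    by (rule mpoly_additive_ext[of "\<lambda>q. partial_deriv i (Poly_Mapping.single m c * q)"])
      (simp_all add: partial_deriv_add distrib_left ss)
  show ?thesis
    by (rule mpoly_additive_ext[of "\<lambda>p. partial_deriv i (p * q)"])
      (simp_all add: partial_deriv_add distrib_right 1)
qed

lemma partial_deriv_sum: "partial_deriv i (sum f A) = (\<Sum>a\<in>A. partial_deriv i (f a))"
  by (induction A rule: infinite_finite_induct) (simp_all add: partial_deriv_add)

lemma partial_deriv_Const: "partial_deriv i (Const c) = 0"
  by (simp add: Const_def partial_deriv_single)

lemma partial_deriv_Var:
  "partial_deriv i (Var j :: 'a::comm_ring_1 mpoly) = (if i = j then 1 else 0)"
  by (auto simp: Var_def partial_deriv_single lookup_single)

lemma partial_deriv_Const_mult: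
  "partial_deriv i (Const c * p) = Const c * partial_deriv i (p :: 'a::comm_ring_1 mpoly)"
  by (simp add: partial_deriv_mult partial_deriv_Const)

lemma partial_deriv_prod:
  fixes f :: "'b \<Rightarrow> 'a::comm_ring_1 mpoly"
  assumes "finite A"
  shows "partial_deriv i (prod f A) = (\<Sum>a\<in>A. partial_deriv i (f a) * prod f (A - {a}))"
  using assms
proof (induction A rule: finite_induct)
  case empty
  show ?case using partial_deriv_Const[of i "1 :: 'a"] by simp
next
  case (insert x F)
  have "(\<Sum>a\<in>F. partial_deriv i (f a) * prod f (insert x F - {a})) =
      f x * (\<Sum>a\<in>F. partial_deriv i (f a) * prod f (F - {a}))"
    unfolding sum_distrib_left
  proof (intro sum.cong refl)
    fix a assume "a \<in> F"
    then have "insert x F - {a} = insert x (F - {a})" using insert.hyps by auto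
    then show "partial_deriv i (f a) * prod f (insert x F - {a}) =
        f x * (partial_deriv i (f a) * prod f (F - {a}))"
      using insert.hyps by (simp add: mult_ac)
  qed
  then show ?case using insert by (simp add: partial_deriv_mult)
qed


section \<open>Leading terms along an arc\<close>

text \<open>\<open>P = c \<epsilon>\<^sup>v + O(\<epsilon>\<^bsup>v + 1\<^esup>)\<close>, where \<open>c\<close> may vanish.\<close>

definition lead :: "'a::comm_ring_1 poly \<Rightarrow> nat \<Rightarrow> 'a \<Rightarrow> bool" where
  "lead P v c \<longleftrightarrow> (\<forall>i<v. coeff P i = 0) \<and> coeff P v = c"

lemma lead_0: "lead 0 v 0"
  by (simp add: lead_def)

lemma lead_const: "lead [:c:] 0 c"
  by (simp add: lead_def)

lemma lead_monom: "lead (monom c v) v c"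
  by (simp add: lead_def)

lemma lead_weaken: "lead P v c \<Longrightarrow> w < v \<Longrightarrow> lead P w 0"
  by (simp add: lead_def)

lemma lead_add: "lead P v c \<Longrightarrow> lead Q v d \<Longrightarrow> lead (P + Q) v (c + d)"
  by (simp add: lead_def)

lemma lead_sum: "(\<And>a. a \<in> A \<Longrightarrow> lead (f a) v (c a)) \<Longrightarrow> lead (sum f A) v (sum c A)"
  by (induction A rule: infinite_finite_induct) (simp_all add: lead_0 lead_add)

lemma lead_mult:
  assumes "lead P v c" "lead Q w d"
  shows "lead (P * Q) (v + w) (c * d)"
proof -
  have P: "\<And>i. i < v \<Longrightarrow> coeff P i = 0" "coeff P v = c"
    and Q: "\<And>i. i < w \<Longrightarrow> coeff Q i = 0" "coeff Q w = d"
    using assms by (auto simp: lead_def)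
  have "coeff (P * Q) i = 0" if "i < v + w" for i
    unfolding coeff_mult
  proof (rule sum.neutral, rule ballI)
    fix j assume "j \<in> {..i}"
    then have "j < v \<or> i - j < w" using that by auto
    then show "coeff P j * coeff Q (i - j) = 0" using P Q by auto
  qed
  moreover have "coeff (P * Q) (v + w) = (\<Sum>j\<le>v + w. if j = v then c * d else 0)"
    unfolding coeff_mult
  proof (intro sum.cong refl)
    fix j assume "j \<in> {..v + w}"
    then have "j < v \<or> j = v \<or> v + w - j < w" by auto
    then show "coeff P j * coeff Q (v + w - j) = (if j = v then c * d else 0)"
      using P Q by auto
  qed
  ultimately show ?thesis by (simp add: lead_def)
qed

lemma lead_prod: "(\<And>a. a \<in> A \<Longrightarrow> lead (f a) (v a) (c a)) \<Longrightarrow> lead (prod f A) (sum v A) (prod c A)"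
  by (induction A rule: infinite_finite_induct) (simp_all add: lead_mult lead_const[of 1, folded one_pCons])

lemma lead_power: "lead P v c \<Longrightarrow> lead (P ^ k) (k * v) (c ^ k)"
  using lead_prod[of "{..<k}" "\<lambda>_. P" "\<lambda>_. v" "\<lambda>_. c"] by simp

lemma lead_unique:
  assumes "lead P v c" "lead P w d" "c \<noteq> 0" "d \<noteq> 0"
  shows "v = w" "c = d"
proof -
  show "v = w" using assms by (metis lead_def linorder_neqE_nat)
  then show "c = d" using assms by (simp add: lead_def)
qed

text \<open>Reduction modulo \<open>B\<close> isolates the lowest digit. With powers of
  \<open>B\<close> as weights, the weighted order of a monomial thus determines its
  exponents.\<close>

lemma digits_unique:
  fixes a :: "nat \<Rightarrow> nat"
  assumes "\<And>m. m \<le> n \<Longrightarrow> a m < B" "\<And>m. m \<le> n \<Longrightarrow> b m < B"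
    and "(\<Sum>m\<le>n. a m * B ^ m) = (\<Sum>m\<le>n. b m * B ^ m)" "m \<le> n"
  shows "a m = b m"
  using assms
proof (induction n arbitrary: a b m)
  case 0
  then show ?case by simp
next
  case (Suc n)
  have split: "(\<Sum>m\<le>Suc n. c m * B ^ m) = c 0 + B * (\<Sum>m\<le>n. c (Suc m) * B ^ m)" for c
    by (subst sum.atMost_Suc_shift) (simp add: sum_distrib_left mult_ac del: sum.atMost_Suc)
  have eq: "a 0 + B * (\<Sum>m\<le>n. a (Suc m) * B ^ m) = b 0 + B * (\<Sum>m\<le>n. b (Suc m) * B ^ m)"
    using Suc.prems(3) unfolding split .
  have lt: "a 0 < B" "b 0 < B" using Suc.prems(1,2) by auto
  have "(a 0 + B * (\<Sum>m\<le>n. a (Suc m) * B ^ m)) mod B = (b 0 + B * (\<Sum>m\<le>n. b (Suc m) * B ^ m)) mod B"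
    by (simp only: eq)
  then have 0: "a 0 = b 0" using lt by simp
  then have "(\<Sum>m\<le>n. a (Suc m) * B ^ m) = (\<Sum>m\<le>n. b (Suc m) * B ^ m)" using eq lt by simp
  then have "a (Suc m') = b (Suc m')" if "m' \<le> n" for m'
    using Suc.IH[of "\<lambda>m. a (Suc m)" "\<lambda>m. b (Suc m)" m'] Suc.prems(1,2) that by auto
  with 0 Suc.prems(4) show ?case by (cases m) auto
qed

text \<open>
  The hypothesis \<open>sep\<close> makes the initial form of \<open>P\<close> for the weights \<open>\<omega>\<close> a monomial in the variables
  \<open>2, \<dots>, n\<close> times a binary form in the variables \<open>0, 1\<close>.
\<close>

lemma lead_ev_homogeneous:
  fixes P :: "'k::idom mpoly" and Q :: "nat \<Rightarrow> 'k poly"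
  assumes P: "homogeneous n e P" "P \<noteq> 0" and n: "n \<ge> 1"
    and lead: "\<And>m. m \<le> n \<Longrightarrow> lead (\<eta> m) (\<omega> m) (Q m)"
    and sep: "\<And>\<alpha> \<beta> m. \<alpha> \<in> Poly_Mapping.keys P \<Longrightarrow> \<beta> \<in> Poly_Mapping.keys P \<Longrightarrow>
      (\<Sum>m\<le>n. Poly_Mapping.lookup \<alpha> m * \<omega> m) = (\<Sum>m\<le>n. Poly_Mapping.lookup \<beta> m * \<omega> m) \<Longrightarrow>
      m \<in> {2..n} \<Longrightarrow> Poly_Mapping.lookup \<alpha> m = Poly_Mapping.lookup \<beta> m"
  obtains \<alpha> c where "\<alpha> \<in> Poly_Mapping.keys P" "c \<noteq> 0"
    "degree c \<le> Poly_Mapping.lookup \<alpha> 0 + Poly_Mapping.lookup \<alpha> 1"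
    "lead (ev (\<lambda>c. [:[:c:]:]) \<eta> P) (\<Sum>m\<le>n. Poly_Mapping.lookup \<alpha> m * \<omega> m)
      ((\<Prod>m\<in>{2..n}. Q m ^ Poly_Mapping.lookup \<alpha> m) *
        binform (Poly_Mapping.lookup \<alpha> 0 + Poly_Mapping.lookup \<alpha> 1) c (Q 0) (Q 1))"
proof -
  define ord where "ord \<alpha> = (\<Sum>m\<le>n. Poly_Mapping.lookup \<alpha> m * \<omega> m)" for \<alpha>
  let ?K = "Poly_Mapping.keys P"
  have "?K \<noteq> {}" using P(2) by simp
  then obtain \<alpha> where \<alpha>: "\<alpha> \<in> ?K" and min: "\<And>\<beta>. \<beta> \<in> ?K \<Longrightarrow> ord \<alpha> \<le> ord \<beta>"
    using ex_has_least_nat[of "\<lambda>x. x \<in> ?K" _ ord] by blast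
  \<comment> \<open>The monomials of least order; they alone contribute to the leading
    coefficient.\<close>
  define T where "T = {\<beta> \<in> ?K. ord \<beta> = ord \<alpha>}"
  have T: "finite T" "T \<subseteq> ?K" "\<alpha> \<in> T" using \<alpha> by (auto simp: T_def)
  have split: "{..n} = insert 0 (insert 1 {2..n})" using n by auto
  have tails: "Poly_Mapping.lookup \<beta> m = Poly_Mapping.lookup \<alpha> m" if "\<beta> \<in> T" "m \<in> {2..n}" for \<beta> m
    using that sep[of \<beta> \<alpha> m] \<alpha> by (auto simp: T_def ord_def)
  define k where "k = Poly_Mapping.lookup \<alpha> 0 + Poly_Mapping.lookup \<alpha> 1"
  \<comment> \<open>The total degree and the exponents beyond 1 are common to all of
    \<open>T\<close>, hence so is the degree in the variables 0 and 1.\<close>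
  have k: "Poly_Mapping.lookup \<beta> 0 + Poly_Mapping.lookup \<beta> 1 = k" if "\<beta> \<in> T" for \<beta>
  proof -
    have "(\<Sum>m\<le>n. Poly_Mapping.lookup \<beta> m) = (\<Sum>m\<le>n. Poly_Mapping.lookup \<alpha> m)"
      using homogeneousD(2)[OF P(1) subsetD[OF T(2) that]] homogeneousD(2)[OF P(1) \<alpha>] by simp
    moreover have "(\<Sum>m\<in>{2..n}. Poly_Mapping.lookup \<beta> m) = (\<Sum>m\<in>{2..n}. Poly_Mapping.lookup \<alpha> m)"
      using tails[OF that] by (intro sum.cong) auto
    ultimately show ?thesis unfolding split k_def by simp
  qed
  define c where "c = (\<Sum>\<beta>\<in>T. monom (Poly_Mapping.lookup P \<beta>) (Poly_Mapping.lookup \<beta> 0))"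
  \<comment> \<open>Within \<open>T\<close> the exponent of the variable 0 identifies a monomial, so
    no coefficients cancel in \<open>c\<close>.\<close>
  have inj: "\<beta> = \<alpha>" if "\<beta> \<in> T" "Poly_Mapping.lookup \<beta> 0 = Poly_Mapping.lookup \<alpha> 0" for \<beta>
  proof (rule poly_mapping_eqI)
    fix m
    have keys: "Poly_Mapping.keys \<beta> \<subseteq> {..n}" "Poly_Mapping.keys \<alpha> \<subseteq> {..n}"
      using homogeneousD(1)[OF P(1) subsetD[OF T(2) that(1)]] homogeneousD(1)[OF P(1) \<alpha>] by simp_all
    have "m \<in> insert 0 (insert 1 {2..n})" if "m \<in> {..n}" using that by (simp only: split)
    then consider "m = 0" | "m = 1" | "m \<in> {2..n}" | "m \<notin> {..n}" by auto
    then show "Poly_Mapping.lookup \<beta> m = Poly_Mapping.lookup \<alpha> m"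
    proof cases
      case 2
      then show ?thesis using k[OF that(1)] that(2) k_def by simp
    next
      case 4
      then show ?thesis using keys by (metis in_keys_iff subset_iff)
    qed (use that tails in auto)
  qed
  have "coeff c (Poly_Mapping.lookup \<alpha> 0) = (\<Sum>\<beta>\<in>T. if \<beta> = \<alpha> then Poly_Mapping.lookup P \<beta> else 0)"
    unfolding c_def coeff_sum using inj by (intro sum.cong refl) (auto)
  also have "\<dots> = Poly_Mapping.lookup P \<alpha>" using T by simp
  finally have "c \<noteq> 0" using \<alpha> by (metis coeff_0 in_keys_iff)
  have "degree c \<le> k"
    unfolding c_def
  proof (rule degree_sum_le[OF T(1)])
    fix \<beta> assume "\<beta> \<in> T"
    have "degree (monom (Poly_Mapping.lookup P \<beta>) (Poly_Mapping.lookup \<beta> 0)) \<le> Poly_Mapping.lookup \<beta> 0"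
      by (rule degree_monom_le)
    with k[OF \<open>\<beta> \<in> T\<close>]
    show "degree (monom (Poly_Mapping.lookup P \<beta>) (Poly_Mapping.lookup \<beta> 0)) \<le> k" by linarith
  qed
  have summand: "lead ([:[:Poly_Mapping.lookup P \<beta>:]:] * (\<Prod>m\<le>n. \<eta> m ^ Poly_Mapping.lookup \<beta> m)) (ord \<beta>)
      ([:Poly_Mapping.lookup P \<beta>:] * (\<Prod>m\<le>n. Q m ^ Poly_Mapping.lookup \<beta> m))" for \<beta>
  proof -
    have "lead (\<Prod>m\<le>n. \<eta> m ^ Poly_Mapping.lookup \<beta> m) (\<Sum>m\<le>n. Poly_Mapping.lookup \<beta> m * \<omega> m)
        (\<Prod>m\<le>n. Q m ^ Poly_Mapping.lookup \<beta> m)"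
      by (intro lead_prod lead_power lead) auto
    from lead_mult[OF lead_const this, of "[:Poly_Mapping.lookup P \<beta>:]"] show ?thesis
      by (simp only: ord_def add_0)
  qed
  have "lead (ev (\<lambda>c. [:[:c:]:]) \<eta> P) (ord \<alpha>)
      (\<Sum>\<beta>\<in>?K. if \<beta> \<in> T then [:Poly_Mapping.lookup P \<beta>:] * (\<Prod>m\<le>n. Q m ^ Poly_Mapping.lookup \<beta> m) else 0)"
    unfolding ev_homogeneous[OF P(1)]
  proof (rule lead_sum)
    fix \<beta> assume \<beta>: "\<beta> \<in> ?K"
    show "lead ([:[:Poly_Mapping.lookup P \<beta>:]:] * (\<Prod>m\<le>n. \<eta> m ^ Poly_Mapping.lookup \<beta> m)) (ord \<alpha>)
      (if \<beta> \<in> T then [:Poly_Mapping.lookup P \<beta>:] * (\<Prod>m\<le>n. Q m ^ Poly_Mapping.lookup \<beta> m) else 0)"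
    proof (cases "\<beta> \<in> T")
      case True
      then show ?thesis using summand[of \<beta>] by (simp add: T_def)
    next
      case False
      then have "ord \<alpha> < ord \<beta>" using min[OF \<beta>] \<beta> by (simp add: T_def)
      then show ?thesis using lead_weaken[OF summand] False by simp
    qed
  qed
  also have "(\<Sum>\<beta>\<in>?K. if \<beta> \<in> T then [:Poly_Mapping.lookup P \<beta>:] * (\<Prod>m\<le>n. Q m ^ Poly_Mapping.lookup \<beta> m) else 0) =
      (\<Sum>\<beta>\<in>T. [:Poly_Mapping.lookup P \<beta>:] * (\<Prod>m\<le>n. Q m ^ Poly_Mapping.lookup \<beta> m))"
    using T by (simp add: sum.If_cases Int_absorb1)
  also have "\<dots> = (\<Sum>\<beta>\<in>T. (\<Prod>m\<in>{2..n}. Q m ^ Poly_Mapping.lookup \<alpha> m) *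
      smult (Poly_Mapping.lookup P \<beta>) (Q 0 ^ Poly_Mapping.lookup \<beta> 0 * Q 1 ^ (k - Poly_Mapping.lookup \<beta> 0)))"
  proof (intro sum.cong refl)
    fix \<beta> assume \<beta>: "\<beta> \<in> T"
    have "(\<Prod>m\<in>{2..n}. Q m ^ Poly_Mapping.lookup \<beta> m) = (\<Prod>m\<in>{2..n}. Q m ^ Poly_Mapping.lookup \<alpha> m)"
      using tails[OF \<beta>] by (intro prod.cong) auto
    moreover have "Poly_Mapping.lookup \<beta> 1 = k - Poly_Mapping.lookup \<beta> 0" using k[OF \<beta>] by simp
    ultimately show "[:Poly_Mapping.lookup P \<beta>:] * (\<Prod>m\<le>n. Q m ^ Poly_Mapping.lookup \<beta> m) =
      (\<Prod>m\<in>{2..n}. Q m ^ Poly_Mapping.lookup \<alpha> m) *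
      smult (Poly_Mapping.lookup P \<beta>) (Q 0 ^ Poly_Mapping.lookup \<beta> 0 * Q 1 ^ (k - Poly_Mapping.lookup \<beta> 0))"
      unfolding split by (simp add: mult_ac)
  qed
  also have "\<dots> = (\<Prod>m\<in>{2..n}. Q m ^ Poly_Mapping.lookup \<alpha> m) * binform k c (Q 0) (Q 1)"
  proof -
    have "binform k c (Q 0) (Q 1) = (\<Sum>i\<le>k. \<Sum>\<beta>\<in>T. if Poly_Mapping.lookup \<beta> 0 = i then
        smult (Poly_Mapping.lookup P \<beta>) (Q 0 ^ i * Q 1 ^ (k - i)) else 0)"
      unfolding binform_def c_def coeff_sum smult_sum
      by (intro sum.cong refl) auto
    also have "\<dots> = (\<Sum>\<beta>\<in>T. \<Sum>i\<le>k. if Poly_Mapping.lookup \<beta> 0 = i then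
        smult (Poly_Mapping.lookup P \<beta>) (Q 0 ^ i * Q 1 ^ (k - i)) else 0)"
      by (rule sum.swap)
    also have "\<dots> = (\<Sum>\<beta>\<in>T. smult (Poly_Mapping.lookup P \<beta>)
        (Q 0 ^ Poly_Mapping.lookup \<beta> 0 * Q 1 ^ (k - Poly_Mapping.lookup \<beta> 0)))"
    proof (intro sum.cong refl)
      fix \<beta> assume "\<beta> \<in> T"
      then have "Poly_Mapping.lookup \<beta> 0 \<le> k" using k by fastforce
      then show "(\<Sum>i\<le>k. if Poly_Mapping.lookup \<beta> 0 = i then
        smult (Poly_Mapping.lookup P \<beta>) (Q 0 ^ i * Q 1 ^ (k - i)) else 0) = smult (Poly_Mapping.lookup P \<beta>)
        (Q 0 ^ Poly_Mapping.lookup \<beta> 0 * Q 1 ^ (k - Poly_Mapping.lookup \<beta> 0))" by simp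
    qed
    finally show ?thesis by (simp add: sum_distrib_left)
  qed
  finally show thesis
    using that[OF \<alpha> \<open>c \<noteq> 0\<close>] \<open>degree c \<le> k\<close> unfolding k_def ord_def by blast
qed

text \<open>
  Here \<open>b i\<close> are the coordinates of the form \<open>L\<^sub>i\<close> in the basis \<open>L\<^bsub>\<sigma> 0\<^esub>, \<dots>, L\<^bsub>\<sigma> n\<^esub>\<close>, the \<open>t m\<close> are the
  values of that basis at a point of an arc, and the argument of \<open>P0\<close> and \<open>P1\<close> is the gradient of \<open>F\<close>
  at that point in the dual coordinates.
\<close>

lemma degeneration:
  fixes b :: "nat \<Rightarrow> nat \<Rightarrow> 'k::field_char_0" and P0 P1 :: "'k mpoly"
  assumes n: "n \<ge> 1"
    and nz: "\<And>i. i \<le> r \<Longrightarrow> \<exists>m\<le>n. b i m \<noteq> 0"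
    and \<sigma>: "\<And>m. m \<le> n \<Longrightarrow> \<sigma> m \<le> r"
      "\<And>m m'. m \<le> n \<Longrightarrow> m' \<le> n \<Longrightarrow> b (\<sigma> m) m' = (if m = m' then 1 else 0)"
    and s: "s \<le> r" "b s 0 \<noteq> 0" "b s 1 \<noteq> 0"
    and P: "homogeneous n e P0" "homogeneous n e P1" "P0 \<noteq> 0" "P1 \<noteq> 0"
  obtains t :: "nat \<Rightarrow> 'k poly poly" where
    "t 0 * ev (\<lambda>c. [:[:c:]:]) (\<lambda>m. \<Sum>i\<le>r. [:[:b i m:]:] * (\<Prod>j\<in>{..r} - {i}. \<Sum>l\<le>n. [:[:b j l:]:] * t l)) P1 \<noteq>
     t 1 * ev (\<lambda>c. [:[:c:]:]) (\<lambda>m. \<Sum>i\<le>r. [:[:b i m:]:] * (\<Prod>j\<in>{..r} - {i}. \<Sum>l\<le>n. [:[:b j l:]:] * t l)) P0"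
proof -
  \<comment> \<open>As \<open>e + 2\<close> exceeds every exponent in \<open>P0\<close> and \<open>P1\<close>, monomials of equal order share all
    exponents of the variables \<open>2, \<dots>, n\<close>.\<close>
  define w where "w m = (if m \<le> 1 then 0 else (e + 2) ^ m)" for m :: nat
  have w01 [simp]: "w 0 = 0" "w (Suc 0) = 0" by (simp_all add: w_def)
  have w_mono: "w m < w m'" if "m < m'" "2 \<le> m'" for m m'
    using that power_strict_increasing[of m m' "e + 2"] by (auto simp: w_def)
  have w_pos: "w m > 0" if "2 \<le> m" for m using that by (simp add: w_def)
  \<comment> \<open>The outer polynomial variable is the arc parameter \<epsilon>, the inner one is
    \<tau>. As \<open>w 1 = 0\<close>, the coordinate \<open>t 1\<close> is 1; \<open>t0\<close>
    records the leading coefficients.\<close>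
  define t where "t m = (if m = 0 then [:[:0, 1:]:] else monom (1 :: 'k poly) (w m))" for m
  define t0 where "t0 m = (if m = 0 then [:0, 1:] else (1 :: 'k poly))" for m :: nat
  define ll where "ll i = (\<Sum>l\<le>n. [:[:b i l:]:] * t l)" for i
  define \<eta> where "\<eta> m = (\<Sum>i\<le>r. [:[:b i m:]:] * (\<Prod>j\<in>{..r} - {i}. ll j))" for m
  \<comment> \<open>The indices of the forms that do not vanish on the line where the coordinates 2
    to n are zero. Off \<open>J\<close>, the first occurring coordinate \<open>\<mu> i\<close> gives
    the lowest order, since the weights increase; \<open>v i\<close> and \<open>c i\<close> are the
    resulting order and leading coefficient.\<close>
  define J where "J = {i. i \<le> r \<and> (b i 0 \<noteq> 0 \<or> b i 1 \<noteq> 0)}"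
  define \<mu> where "\<mu> i = (LEAST m. m \<le> n \<and> b i m \<noteq> 0)" for i
  define v where "v i = (if i \<in> J then 0 else w (\<mu> i))" for i
  define c where "c i = (if i \<in> J then [:b i 1, b i 0:] else [:b i (\<mu> i):])" for i
  have \<mu>: "\<mu> i \<le> n" "b i (\<mu> i) \<noteq> 0" if "i \<le> r" for i
    using LeastI_ex[of "\<lambda>m. m \<le> n \<and> b i m \<noteq> 0"] nz[OF that] unfolding \<mu>_def by blast+
  have \<mu>_le: "\<mu> i \<le> m" if "m \<le> n" "b i m \<noteq> 0" for i m
    unfolding \<mu>_def using that by (intro Least_le) blast
  have \<mu>2: "2 \<le> \<mu> i" if "i \<le> r" "i \<notin> J" for i
  proof (rule ccontr)
    assume "\<not> 2 \<le> \<mu> i"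
    then have "\<mu> i = 0 \<or> \<mu> i = 1" by auto
    then show False using \<mu>(2)[OF that(1)] that by (auto simp: J_def)
  qed
  have c0: "c i \<noteq> 0" if "i \<le> r" for i
    using \<mu>(2)[OF that] that by (auto simp: c_def J_def)
  have lt: "lead ([:[:b i m:]:] * t m) (w m) ([:b i m:] * t0 m)" for i m
  proof -
    have "lead (t m) (w m) (t0 m)"
      by (cases "m = 0") (simp_all add: t_def t0_def lead_const lead_monom)
    from lead_mult[OF lead_const this, of "[:b i m:]"] show ?thesis by (simp only: add_0)
  qed
  have lead_ll: "lead (ll i) (v i) (c i)" if i: "i \<le> r" for i
  proof (cases "i \<in> J")
    case True
    have "lead (ll i) 0 (\<Sum>l\<le>n. if l \<le> 1 then [:b i l:] * t0 l else 0)"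
      unfolding ll_def
    proof (rule lead_sum)
      fix l
      show "lead ([:[:b i l:]:] * t l) 0 (if l \<le> 1 then [:b i l:] * t0 l else 0)"
      proof (cases "l \<le> 1")
        case True
        then show ?thesis using lt[of i l] by (simp add: w_def)
      next
        case False
        then show ?thesis using lead_weaken[OF lt w_pos] by simp
      qed
    qed
    also have "(\<Sum>l\<le>n. if l \<le> 1 then [:b i l:] * t0 l else 0) = (\<Sum>l\<le>1. [:b i l:] * t0 l)"
      using n by (intro sum.mono_neutral_cong_right) auto
    also have "\<dots> = c i" using True by (simp add: c_def t0_def)
    finally show ?thesis using True by (simp add: v_def)
  next
    case False
    have "lead (ll i) (w (\<mu> i)) (\<Sum>l\<le>n. if l = \<mu> i then [:b i l:] * t0 l else 0)"
      unfolding ll_def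
    proof (rule lead_sum)
      fix l assume l: "l \<in> {..n}"
      consider "l < \<mu> i" | "l = \<mu> i" | "\<mu> i < l" by linarith
      then show "lead ([:[:b i l:]:] * t l) (w (\<mu> i)) (if l = \<mu> i then [:b i l:] * t0 l else 0)"
      proof cases
        case 1
        then have "b i l = 0" using \<mu>_le[of l i] l by auto
        then show ?thesis using 1 by (simp add: lead_0)
      next
        case 2
        then show ?thesis using lt[of i "\<mu> i"] by (simp only: if_True refl)
      next
        case 3
        then show ?thesis using lead_weaken[OF lt w_mono[OF 3]] \<mu>2[OF i False] by simp
      qed
    qed
    also have "(\<Sum>l\<le>n. if l = \<mu> i then [:b i l:] * t0 l else 0) = c i"
      using \<mu>(1)[OF i] \<mu>2[OF i False] False by (simp add: c_def t0_def)
    finally show ?thesis using False by (simp add: v_def)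
  qed

  \<comment> \<open>\<open>W\<close> and \<open>f\<close> are the order and the leading coefficient
    of the product of all forms along the arc. Forms outside \<open>J\<close> contribute only
    nonzero constants to \<open>f\<close>.\<close>
  define W where "W = (\<Sum>i\<le>r. v i)"
  define f where "f = (\<Prod>i\<le>r. c i)"
  define W' where "W' i = (\<Sum>j\<in>{..r} - {i}. v j)" for i
  define f' where "f' i = (\<Prod>j\<in>{..r} - {i}. c j)" for i
  have WW': "W = v i + W' i" and ff': "f = c i * f' i" if "i \<le> r" for i
    using that by (simp_all add: W_def W'_def f_def f'_def sum.remove prod.remove)
  have f0: "f \<noteq> 0" unfolding f_def using c0 by simp
  have lead_term: "lead ([:[:b i m:]:] * (\<Prod>j\<in>{..r} - {i}. ll j)) (W' i) ([:b i m:] * f' i)" for i m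
  proof -
    have "lead (\<Prod>j\<in>{..r} - {i}. ll j) (W' i) (f' i)"
      unfolding W'_def f'_def by (intro lead_prod lead_ll) auto
    from lead_mult[OF lead_const this, of "[:b i m:]"] show ?thesis by (simp only: add_0)
  qed
  \<comment> \<open>Only forms in \<open>J\<close> involve the coordinates 0 and 1. They have order
    0, so omitting one of them does not change the order of the product.\<close>
  have lead01: "lead (\<eta> m) W (\<Sum>i\<le>r. [:b i m:] * f' i)" if "m \<le> 1" for m
    unfolding \<eta>_def
  proof (rule lead_sum)
    fix i assume i: "i \<in> {..r}"
    show "lead ([:[:b i m:]:] * (\<Prod>j\<in>{..r} - {i}. ll j)) W ([:b i m:] * f' i)"
    proof (cases "b i m = 0")
      case True
      then show ?thesis by (simp add: lead_0)
    next
      case False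
      have "m = 0 \<or> m = 1" using that by auto
      with False i have "i \<in> J" by (auto simp: J_def)
      then show ?thesis using lead_term[of i m] WW'[of i] i by (simp add: v_def)
    qed
  qed
  \<comment> \<open>The number of forms in \<open>J\<close> is the degree of the binary form on the
    line, counting its zero at infinity.\<close>
  define N where "N = card J"
  define q where "q = of_nat N * f - [:0, 1:] * pderiv f"
  have J: "finite J" "J \<subseteq> {..r}" by (auto simp: J_def)
  have "(\<Sum>i\<le>r. [:b i 0:] * f' i) = pderiv f"
    unfolding f_def pderiv_prod
  proof (intro sum.cong refl)
    fix i assume "i \<in> {..r}"
    then have "pderiv (c i) = [:b i 0:]" by (auto simp: c_def J_def pderiv_pCons)
    then show "[:b i 0:] * f' i = prod c ({..r} - {i}) * pderiv (c i)"
      by (simp add: f'_def)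
  qed
  then have lead0: "lead (\<eta> 0) W (pderiv f)" using lead01[of 0] by simp
  \<comment> \<open>Euler's relation for the binary form: every factor from \<open>J\<close>
    restores \<open>f\<close> once, while the others have no part in the coordinates 0 and
    1.\<close>
  have "[:0, 1:] * pderiv f + (\<Sum>i\<le>r. [:b i 1:] * f' i) = (\<Sum>i\<le>r. [:b i 1, b i 0:] * f' i)"
    unfolding \<open>(\<Sum>i\<le>r. [:b i 0:] * f' i) = pderiv f\<close>[symmetric] sum_distrib_left sum.distrib[symmetric]
  proof (intro sum.cong refl)
    fix i
    have "[:b i 1, b i 0:] = [:0, 1:] * [:b i 0:] + [:b i 1:]" by simp
    then show "[:0, 1:] * ([:b i 0:] * f' i) + [:b i 1:] * f' i = [:b i 1, b i 0:] * f' i"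
      by (simp only: distrib_right mult.assoc)
  qed
  also have "\<dots> = (\<Sum>i\<le>r. if i \<in> J then f else 0)"
  proof (intro sum.cong refl)
    fix i assume "i \<in> {..r}"
    then show "[:b i 1, b i 0:] * f' i = (if i \<in> J then f else 0)"
      using ff'[of i] by (auto simp: c_def J_def)
  qed
  also have "\<dots> = of_nat N * f"
    using J by (simp add: sum.If_cases Int_absorb1 N_def)
  finally have "(\<Sum>i\<le>r. [:b i 1:] * f' i) = q" unfolding q_def by (simp add: algebra_simps)
  then have lead1: "lead (\<eta> 1) W q" using lead01[of 1] by simp

  \<comment> \<open>This counts the forms whose omission lowers the order by exactly
    \<open>w m\<close> and whose coefficient at \<open>m\<close> is nonzero. The basis form
    \<open>\<sigma> m\<close> is one of them, so the count is positive.\<close>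
  define M where "M m = card {i. i \<le> r \<and> i \<notin> J \<and> \<mu> i = m}" for m
  have \<sigma>J: "\<sigma> m \<notin> J" "\<mu> (\<sigma> m) = m" if "m \<in> {2..n}" for m
  proof -
    show "\<sigma> m \<notin> J" using that \<sigma>(2)[of m 0] \<sigma>(2)[of m 1] n by (auto simp: J_def)
    have "b (\<sigma> m) (\<mu> (\<sigma> m)) \<noteq> 0" "\<mu> (\<sigma> m) \<le> n" using \<mu>[of "\<sigma> m"] \<sigma>(1)[of m] that by auto
    then show "\<mu> (\<sigma> m) = m" using \<sigma>(2)[of m "\<mu> (\<sigma> m)"] that by (auto split: if_splits)
  qed
  have wW: "w m \<le> W" if "m \<in> {2..n}" for m
    using WW'[of "\<sigma> m"] \<sigma>J[OF that] \<sigma>(1)[of m] that by (simp add: v_def)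
  have M0: "M m > 0" if "m \<in> {2..n}" for m
  proof -
    have "\<sigma> m \<in> {i. i \<le> r \<and> i \<notin> J \<and> \<mu> i = m}" using \<sigma>J[OF that] \<sigma>(1)[of m] that by auto
    then show ?thesis unfolding M_def by (auto simp: card_gt_0_iff)
  qed
  have lead2: "lead (\<eta> m) (W - w m) (of_nat (M m) * f)" if m: "m \<in> {2..n}" for m
  proof -
    have "lead (\<eta> m) (W - w m) (\<Sum>i\<le>r. if i \<notin> J \<and> \<mu> i = m then f else 0)"
      unfolding \<eta>_def
    proof (rule lead_sum)
      fix i assume "i \<in> {..r}"
      then have i: "i \<le> r" by simp
      let ?g = "if i \<notin> J \<and> \<mu> i = m then f else 0"
      \<comment> \<open>In the last two cases the omitted form has order below \<open>w m\<close>,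
        so the summand has order above \<open>W - w m\<close>. If \<open>\<mu> i\<close> exceeds
        \<open>m\<close>, the coefficient at \<open>m\<close> is zero.\<close>
      consider "i \<notin> J" "\<mu> i = m" | "b i m = 0" | "i \<in> J" | "i \<notin> J" "\<mu> i < m"
        using \<mu>_le[of m i] m by fastforce
      then show "lead ([:[:b i m:]:] * (\<Prod>j\<in>{..r} - {i}. ll j)) (W - w m) ?g"
      proof cases
        case 1
        then have "W - w m = W' i" "f = [:b i m:] * f' i"
          using WW'[OF i] ff'[OF i] by (simp_all add: v_def c_def)
        then show ?thesis using lead_term[of i m] 1 by simp
      next
        case 2
        then have "?g = 0" using \<mu>(2)[OF i] by auto
        then show ?thesis using 2 by (simp add: lead_0)
      next
        case 3
        then have "W - w m < W' i" using WW'[OF i] w_pos[of m] wW[OF m] m by (simp add: v_def)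
        then show ?thesis using lead_weaken[OF lead_term] 3 by simp
      next
        case 4
        then have "W - w m < W' i" using WW'[OF i] w_mono[of "\<mu> i" m] wW[OF m] m by (simp add: v_def)
        then show ?thesis using lead_weaken[OF lead_term] 4 by simp
      qed
    qed
    also have "(\<Sum>i\<le>r. if i \<notin> J \<and> \<mu> i = m then f else 0) = of_nat (M m) * f"
    proof -
      have "{..r} \<inter> {i. i \<notin> J \<and> \<mu> i = m} = {i. i \<le> r \<and> i \<notin> J \<and> \<mu> i = m}" by auto
      then show ?thesis by (simp add: sum.If_cases M_def)
    qed
    finally show ?thesis .
  qed
  define Q where "Q m = (if m = 0 then pderiv f else if m = 1 then q else of_nat (M m) * f)" for m :: nat
  have lead: "lead (\<eta> m) (W - w m) (Q m)" if "m \<le> n" for m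
  proof -
    consider "m = 0" | "m = 1" | "m \<in> {2..n}" using \<open>m \<le> n\<close> by fastforce
    then show ?thesis
      using lead0 lead1 lead2[of m] by cases (auto simp: Q_def)
  qed
  have Q_nz: "(\<Prod>m\<in>{2..n}. Q m ^ a m) \<noteq> 0" for a
    using f0 M0 by (auto simp: Q_def)

  have sep: "Poly_Mapping.lookup \<alpha> m = Poly_Mapping.lookup \<beta> m"
    if hom: "(\<Sum>m\<le>n. Poly_Mapping.lookup \<alpha> m) = e" "(\<Sum>m\<le>n. Poly_Mapping.lookup \<beta> m) = e"
      and ord: "(\<Sum>m\<le>n. Poly_Mapping.lookup \<alpha> m * (W - w m)) = (\<Sum>m\<le>n. Poly_Mapping.lookup \<beta> m * (W - w m))"
      and m: "m \<in> {2..n}" for \<alpha> \<beta> :: "nat \<Rightarrow>\<^sub>0 nat" and m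
  proof -
    \<comment> \<open>Exponents of weight zero are dropped, so that the total weight of the
      exponents is the number with base \<open>e + 2\<close> digits \<open>d \<gamma> m\<close>. By
      homogeneity the order is \<open>e * W\<close> minus this number.\<close>
    define d where "d \<gamma> m = (if m \<le> 1 then 0 else Poly_Mapping.lookup \<gamma> m)" for \<gamma> :: "nat \<Rightarrow>\<^sub>0 nat" and m
    have eq: "(\<Sum>m\<le>n. d \<gamma> m * (e + 2) ^ m) + (\<Sum>m\<le>n. Poly_Mapping.lookup \<gamma> m * (W - w m)) = e * W"
      if "(\<Sum>m\<le>n. Poly_Mapping.lookup \<gamma> m) = e" for \<gamma>
    proof -
      have "e * W = (\<Sum>m\<le>n. Poly_Mapping.lookup \<gamma> m * W)"
        by (simp only: that flip: sum_distrib_right)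
      also have "\<dots> = (\<Sum>m\<le>n. d \<gamma> m * (e + 2) ^ m + Poly_Mapping.lookup \<gamma> m * (W - w m))"
      proof (intro sum.cong refl)
        fix m assume "m \<in> {..n}"
        then have "w m \<le> W" using wW[of m] by (cases "m \<le> 1") (auto simp: w_def)
        moreover have "d \<gamma> m * (e + 2) ^ m = Poly_Mapping.lookup \<gamma> m * w m"
          by (simp add: d_def w_def)
        ultimately show "Poly_Mapping.lookup \<gamma> m * W =
            d \<gamma> m * (e + 2) ^ m + Poly_Mapping.lookup \<gamma> m * (W - w m)"
          by (simp flip: distrib_left)
      qed
      finally show ?thesis by (simp only: sum.distrib)
    qed
    have "(\<Sum>m\<le>n. d \<alpha> m * (e + 2) ^ m) = (\<Sum>m\<le>n. d \<beta> m * (e + 2) ^ m)"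
      using eq[OF hom(1)] eq[OF hom(2)] ord by linarith
    moreover have "d \<gamma> m < e + 2" if "(\<Sum>m\<le>n. Poly_Mapping.lookup \<gamma> m) = e" "m \<le> n" for \<gamma> m
    proof -
      have "Poly_Mapping.lookup \<gamma> m \<le> (\<Sum>m\<le>n. Poly_Mapping.lookup \<gamma> m)"
        using that(2) by (intro member_le_sum) auto
      with that(1) show ?thesis by (simp add: d_def)
    qed
    ultimately have "d \<alpha> m = d \<beta> m"
      using digits_unique[of n "d \<alpha>" "e + 2" "d \<beta>" m] hom m by simp
    with m show ?thesis by (simp add: d_def)
  qed

  have sumk: "(\<Sum>m\<le>n. Poly_Mapping.lookup \<alpha> m) = e" if "\<alpha> \<in> Poly_Mapping.keys P0 \<union> Poly_Mapping.keys P1" for \<alpha>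
    using that homogeneousD(2)[OF P(1)] homogeneousD(2)[OF P(2)] by blast
  let ?E = "ev (\<lambda>c. [:[:c:]:]) \<eta>"
  let ?ord = "\<lambda>\<alpha>. \<Sum>m\<le>n. Poly_Mapping.lookup \<alpha> m * (W - w m)"
  let ?k = "\<lambda>\<alpha>. Poly_Mapping.lookup \<alpha> 0 + Poly_Mapping.lookup \<alpha> 1"
  let ?R = "\<lambda>\<alpha>. \<Prod>m\<in>{2..n}. Q m ^ Poly_Mapping.lookup \<alpha> m"
  obtain \<alpha> c0 where \<alpha>: "\<alpha> \<in> Poly_Mapping.keys P0" "c0 \<noteq> 0" "degree c0 \<le> ?k \<alpha>"
    "lead (?E P0) (?ord \<alpha>) (?R \<alpha> * binform (?k \<alpha>) c0 (Q 0) (Q 1))"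
    by (rule lead_ev_homogeneous[OF P(1) P(3) n, of \<eta> "\<lambda>m. W - w m" Q])
      (use lead sep sumk in blast)+
  obtain \<beta> c1 where \<beta>: "\<beta> \<in> Poly_Mapping.keys P1" "c1 \<noteq> 0" "degree c1 \<le> ?k \<beta>"
    "lead (?E P1) (?ord \<beta>) (?R \<beta> * binform (?k \<beta>) c1 (Q 0) (Q 1))"
    by (rule lead_ev_homogeneous[OF P(2) P(4) n, of \<eta> "\<lambda>m. W - w m" Q])
      (use lead sep sumk in blast)+
  have Q01: "Q 0 = pderiv f" "Q 1 = q" by (simp_all add: Q_def)

  \<comment> \<open>The three distinct zeros on the line: the basis form with index 1 vanishes at
    infinity, which lowers \<open>degree f\<close> below \<open>N\<close>; the one with index 0
    vanishes at 0; the form \<open>s\<close> vanishes at a finite nonzero point.\<close>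
  have "\<sigma> 1 \<in> J" using \<sigma>(1)[of 1] \<sigma>(2)[of 1 1] n by (simp add: J_def)
  have "degree f \<le> (\<Sum>i\<le>r. degree (c i))" unfolding f_def using degree_prod_sum_le[of "{..r}" c] by simp
  also have "\<dots> \<le> (\<Sum>i\<le>r. if i \<in> J - {\<sigma> 1} then 1 else 0)"
  proof (rule sum_mono)
    fix i
    have "b (\<sigma> 1) 0 = 0" using \<sigma>(2)[of 1 0] n by simp
    then show "degree (c i) \<le> (if i \<in> J - {\<sigma> 1} then 1 else 0)"
      by (auto simp: c_def)
  qed
  also have "\<dots> = card (J - {\<sigma> 1})"
  proof -
    have "{..r} \<inter> {i. i \<in> J - {\<sigma> 1}} = J - {\<sigma> 1}" using J by auto
    then show ?thesis by (simp only: sum.If_cases[OF finite_atMost] card_eq_sum) simp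
  qed
  also have "\<dots> < N" unfolding N_def using J \<open>\<sigma> 1 \<in> J\<close> by (intro psubset_card_mono) auto
  finally have degN: "degree f < N" .
  have rootI: "poly f x = 0" if "i \<le> r" "poly (c i) x = 0" for i x
    using ff'[OF that(1)] that(2) by simp
  have root0: "poly f 0 = 0"
    using \<sigma>(1)[of 0] \<sigma>(2)[of 0 0] \<sigma>(2)[of 0 1] n
    by (intro rootI[of "\<sigma> 0"]) (auto simp: c_def J_def)
  have roots: "poly f (- b s 1 / b s 0) = 0"
    using s by (intro rootI[of s]) (auto simp: c_def J_def)
  have ne: "0 \<noteq> - b s 1 / b s 0" using s by simp
  note U = no_log_derivative_left_inverse[OF f0 degN root0 roots ne, folded q_def]

  have "binform (?k \<alpha>) c0 (Q 0) (Q 1) \<noteq> 0"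
    unfolding Q01 by (rule U(2)[OF \<alpha>(2) \<alpha>(2) \<alpha>(3) \<alpha>(3)])
  then have nz0: "?R \<alpha> * binform (?k \<alpha>) c0 (Q 0) (Q 1) \<noteq> 0"
    using Q_nz by simp
  have "binform (?k \<beta>) c1 (Q 0) (Q 1) \<noteq> 0"
    unfolding Q01 by (rule U(2)[OF \<beta>(2) \<beta>(2) \<beta>(3) \<beta>(3)])
  then have nz1: "[:0, 1:] * (?R \<beta> * binform (?k \<beta>) c1 (Q 0) (Q 1)) \<noteq> 0"
    using Q_nz by simp
  have "t 0 * ?E P1 \<noteq> t 1 * ?E P0"
  proof
    have t01: "t 0 = [:[:0, 1:]:]" "t 1 = 1" by (simp_all add: t_def)
    assume "t 0 * ?E P1 = t 1 * ?E P0"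
    then have eq: "?E P0 = [:[:0, 1:]:] * ?E P1" by (simp only: t01 mult_1)
    have "lead (?E P0) (?ord \<beta>) ([:0, 1:] * (?R \<beta> * binform (?k \<beta>) c1 (Q 0) (Q 1)))"
      using lead_mult[OF lead_const \<beta>(4), of "[:0, 1:]"] unfolding eq by (simp only: add_0)
    \<comment> \<open>Nonzero leading coefficients force equal orders and equal coefficients. Equal
      orders give equal exponents beyond 1, hence equal formal degrees, and cancelling the common
      monomial leaves the relation excluded by \<open>U(1)\<close>.\<close>
    note uniq = lead_unique[OF \<alpha>(4) this nz0 nz1]
    have tail: "Poly_Mapping.lookup \<alpha> m = Poly_Mapping.lookup \<beta> m" if "m \<in> {2..n}" for m
      using sep[OF sumk sumk uniq(1) that] \<alpha>(1) \<beta>(1) by blast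
    then have R: "?R \<alpha> = ?R \<beta>" by (intro prod.cong) auto
    have split: "{..n} = insert 0 (insert 1 {2..n})" using n by auto
    have "(\<Sum>m\<le>n. Poly_Mapping.lookup \<alpha> m) = (\<Sum>m\<le>n. Poly_Mapping.lookup \<beta> m)"
      using sumk \<alpha>(1) \<beta>(1) by simp
    moreover have "(\<Sum>m\<in>{2..n}. Poly_Mapping.lookup \<alpha> m) = (\<Sum>m\<in>{2..n}. Poly_Mapping.lookup \<beta> m)"
      using tail by (intro sum.cong) auto
    ultimately have k: "?k \<alpha> = ?k \<beta>" unfolding split by simp
    have "?R \<beta> * binform (?k \<beta>) c0 (Q 0) (Q 1) = ?R \<beta> * ([:0, 1:] * binform (?k \<beta>) c1 (Q 0) (Q 1))"
      using uniq(2) unfolding R k by (simp only: mult.left_commute)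
    then have "binform (?k \<beta>) c0 (pderiv f) q = [:0, 1:] * binform (?k \<beta>) c1 (pderiv f) q"
      using Q_nz by (simp only: mult_cancel_left Q01) simp
    moreover have "degree c0 \<le> ?k \<beta>" using \<alpha>(3) k by simp
    ultimately show False using U(1)[OF \<alpha>(2) \<beta>(2) _ \<beta>(3)] by blast
  qed
  then show thesis using that[of t] unfolding \<eta>_def ll_def by blast
qed


section \<open>Linear forms\<close>

interpretation mpoly_vs: vector_space "\<lambda>c (p :: 'k::field mpoly). Const c * p"
  by unfold_locales (simp_all add: algebra_simps Const.hom_add Const.hom_mult)

lemma lookup_Const_mult:
  "Poly_Mapping.lookup (Const c * p) m = c * Poly_Mapping.lookup (p :: 'a::comm_ring_1 mpoly) m"
  unfolding Const_def mult_map_scale_conv_mult[symmetric] by (simp add: map.rep_eq when_def)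

lemma lin_indep_familyD:
  assumes "lin_indep_family n K" "(\<Sum>m\<le>n. Const (c m) * K m) = (\<Sum>m\<le>n. Const (d m) * K m)" "m \<le> n"
  shows "c m = (d m :: 'a::comm_ring_1)"
proof -
  have "(\<Sum>m\<le>n. Const (c m - d m) * K m) = 0"
    using assms(2) by (simp add: Const.hom_minus left_diff_distrib sum_subtractf)
  then show ?thesis using assms(1,3) unfolding lin_indep_family_def by fastforce
qed

text \<open>The derivative by one variable isolates its coefficient.\<close>

lemma lin_indep_family_Var: "lin_indep_family n (Var :: nat \<Rightarrow> 'a::comm_ring_1 mpoly)"
  unfolding lin_indep_family_def
proof (intro allI impI)
  fix c :: "nat \<Rightarrow> 'a" and j
  assume eq: "(\<Sum>i\<le>n. Const (c i) * Var i) = 0" and j: "j \<le> n"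
  have "partial_deriv j (\<Sum>i\<le>n. Const (c i) * Var i) = (\<Sum>i\<le>n. if i = j then Const (c i) else 0)"
    unfolding partial_deriv_sum partial_deriv_Const_mult partial_deriv_Var
    by (intro sum.cong) auto
  with eq j show "c j = 0" by simp
qed

text \<open>Inserting one expansion into the other expresses \<open>K m\<close> through the
  independent family itself; comparing coefficients shows that the product of the two matrices is
  the identity.\<close>

lemma lin_indep_family_dual:
  fixes K :: "nat \<Rightarrow> 'a::comm_ring_1 mpoly"
  assumes "lin_indep_family n K"
    and A: "\<And>m. m \<le> n \<Longrightarrow> K m = (\<Sum>j\<le>n. Const (A m j) * K' j)"
    and C: "\<And>j. j \<le> n \<Longrightarrow> K' j = (\<Sum>m\<le>n. Const (C j m) * K m)"
    and "m \<le> n" "m' \<le> n"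
  shows "(\<Sum>j\<le>n. A m j * C j m') = (if m = m' then 1 else 0)"
proof (rule lin_indep_familyD[OF assms(1) _ assms(5), of "\<lambda>m'. \<Sum>j\<le>n. A m j * C j m'" "\<lambda>m'. if m = m' then 1 else 0"])
  have "(\<Sum>m'\<le>n. Const (\<Sum>j\<le>n. A m j * C j m') * K m') = (\<Sum>j\<le>n. Const (A m j) * (\<Sum>m'\<le>n. Const (C j m') * K m'))"
    unfolding Const.hom_sum Const.hom_mult sum_distrib_left sum_distrib_right mult.assoc
    by (rule sum.swap)
  also have "\<dots> = K m" using A[OF assms(4)] C by simp
  also have "\<dots> = (\<Sum>m'\<le>n. if m = m' then K m' else 0)" using assms(4) by simp
  also have "\<dots> = (\<Sum>m'\<le>n. Const (if m = m' then 1 else 0) * K m')" by (intro sum.cong) auto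
  finally show "(\<Sum>m'\<le>n. Const (\<Sum>j\<le>n. A m j * C j m') * K m') = (\<Sum>m'\<le>n. Const (if m = m' then 1 else 0) * K m')" .
qed

lemma partial_deriv_linear_form:
  fixes p :: "'a::comm_ring_1 mpoly"
  assumes "linear_form n p" "j \<le> n"
  shows "partial_deriv j p = Const (Poly_Mapping.lookup p (Poly_Mapping.single j 1))"
proof -
  have "partial_deriv j p = (\<Sum>i\<le>n. if i = j then Const (Poly_Mapping.lookup p (Poly_Mapping.single i 1)) else 0)"
    by (subst linear_form_expand[OF assms(1)], unfold partial_deriv_sum partial_deriv_Const_mult partial_deriv_Var)
      (intro sum.cong, auto)
  with assms(2) show ?thesis by simp
qed

text \<open>Take a maximal independent subset of the forms. If it spans all variables, it is a basis
  of the linear forms. Otherwise some variable is independent of it, and a functional that is 1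
  there and 0 on the subset takes on the variables the coordinates of a common zero.\<close>

lemma linear_forms_basis_or_kernel:
  fixes L :: "nat \<Rightarrow> 'k::field mpoly"
  assumes L: "\<And>i. i \<le> r \<Longrightarrow> linear_form n (L i)"
  obtains (kernel) v where "\<exists>j\<le>n. v j \<noteq> 0"
      "\<And>i. i \<le> r \<Longrightarrow> (\<Sum>j\<le>n. Poly_Mapping.lookup (L i) (Poly_Mapping.single j 1) * v j) = 0"
    | (basis) S where "S \<subseteq> {..r}" "card S = Suc n" "inj_on L S" "mpoly_vs.independent (L ` S)"
      "\<And>p. linear_form n p \<Longrightarrow> p \<in> mpoly_vs.span (L ` S)"
proof -
  obtain B where B: "B \<subseteq> L ` {..r}" "mpoly_vs.independent B" "L ` {..r} \<subseteq> mpoly_vs.span B"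
    using mpoly_vs.maximal_independent_subset[of "L ` {..r}"] by blast
  obtain S where S: "S \<subseteq> {..r}" "inj_on L S" "B = L ` S"
    using B(1) unfolding subset_image_inj by blast
  let ?V = "Var ` {..n} :: 'k mpoly set"
  have spanV: "p \<in> mpoly_vs.span ?V" if "linear_form n p" for p
  proof -
    have "(\<Sum>j\<le>n. Const (Poly_Mapping.lookup p (Poly_Mapping.single j 1)) * Var j) \<in> mpoly_vs.span ?V"
      by (intro mpoly_vs.span_sum mpoly_vs.span_scale mpoly_vs.span_base) auto
    then show ?thesis using linear_form_expand[OF that] by simp
  qed
  show thesis
  proof (cases "?V \<subseteq> mpoly_vs.span B")
    case True
    have injV: "inj_on (Var :: nat \<Rightarrow> 'k mpoly) {..n}"
    proof (rule inj_onI)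
      fix i j assume "Var i = (Var j :: 'k mpoly)"
      then have "partial_deriv i (Var i) = (partial_deriv i (Var j) :: 'k mpoly)" by simp
      then show "i = j" by (simp add: partial_deriv_Var split: if_splits)
    qed
    have indV: "mpoly_vs.independent ?V"
    proof (rule mpoly_vs.independent_if_scalars_zero)
      fix f :: "'k mpoly \<Rightarrow> 'k" and x assume "(\<Sum>x\<in>?V. Const (f x) * x) = 0" and x: "x \<in> ?V"
      then have "(\<Sum>j\<le>n. Const (f (Var j)) * Var j) = 0"
        by (simp add: sum.reindex[OF injV])
      then show "f x = 0"
        using lin_indep_family_Var[of n] x unfolding lin_indep_family_def by auto
    qed simp
    have "mpoly_vs.span B = mpoly_vs.span ?V"
    proof
      have "B \<subseteq> mpoly_vs.span ?V" using B(1) L spanV by auto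
      then show "mpoly_vs.span B \<subseteq> mpoly_vs.span ?V" by (rule mpoly_vs.span_minimal) simp
      show "mpoly_vs.span ?V \<subseteq> mpoly_vs.span B" using True by (rule mpoly_vs.span_minimal) simp
    qed
    moreover from this have "card B = card ?V"
      using mpoly_vs.dim_span_eq_card_independent[OF B(2)] mpoly_vs.dim_span_eq_card_independent[OF indV] by simp
    then have "card S = Suc n" using S(2,3) injV by (simp add: card_image)
    ultimately show thesis using basis[of S] S B spanV by metis
  next
    case False
    then obtain j where j: "j \<le> n" "Var j \<notin> mpoly_vs.span B" by auto
    interpret pair: vector_space_pair "\<lambda>c (p :: 'k mpoly). Const c * p" "\<lambda>(c :: 'k) x. c * x"
      by unfold_locales (simp_all add: algebra_simps)
    have "mpoly_vs.independent (insert (Var j) B)"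
      using mpoly_vs.independent_insertI[OF j(2) B(2)] .
    from pair.linear_independent_extend[OF this, of "\<lambda>x. if x = Var j then 1 else 0"]
    obtain g where g: "Vector_Spaces.linear (\<lambda>c (p :: 'k mpoly). Const c * p) (*) g"
      and gB: "\<And>x. x \<in> insert (Var j) B \<Longrightarrow> g x = (if x = Var j then 1 else 0)" by blast
    interpret g: Vector_Spaces.linear "\<lambda>c (p :: 'k mpoly). Const c * p" "(*)" g by (rule g)
    have "g x = 0" if "x \<in> B" for x
      using gB[of x] that j(2) mpoly_vs.span_base[of x B] by auto
    then have g0: "g x = 0" if "x \<in> mpoly_vs.span B" for x
      using g.eq_0_on_span that by blast
    show thesis
    proof (rule kernel[of "\<lambda>j. g (Var j)"])
      show "\<exists>j\<le>n. g (Var j) \<noteq> 0" using j gB[of "Var j"] by auto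
      fix i assume i: "i \<le> r"
      have "0 = g (L i)" using g0 B(3) i by auto
      also have "L i = (\<Sum>j\<le>n. Const (Poly_Mapping.lookup (L i) (Poly_Mapping.single j 1)) * Var j)"
        by (rule linear_form_expand[OF L[OF i]])
      finally show "(\<Sum>j\<le>n. Poly_Mapping.lookup (L i) (Poly_Mapping.single j 1) * g (Var j)) = 0"
        by (simp add: g.sum g.scale)
    qed
  qed
qed

lemma independent_image_lin_indep_family:
  fixes L :: "nat \<Rightarrow> 'k::field mpoly"
  assumes ind: "mpoly_vs.independent (L ` S)" and inj: "inj_on L S" and \<sigma>: "bij_betw \<sigma> {..n} S"
  shows "lin_indep_family n (\<lambda>m. L (\<sigma> m))"
  unfolding lin_indep_family_def
proof (intro allI impI)
  fix c :: "nat \<Rightarrow> 'k" and m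
  assume eq: "(\<Sum>i\<le>n. Const (c i) * L (\<sigma> i)) = 0" and m: "m \<le> n"
  have inj': "inj_on (\<lambda>i. L (\<sigma> i)) {..n}" and im: "(\<lambda>i. L (\<sigma> i)) ` {..n} = L ` S"
    using inj \<sigma> comp_inj_on[of \<sigma> "{..n}" L] by (auto simp: bij_betw_def comp_def)
  \<comment> \<open>The coefficients, carried from indices to the forms themselves; this is well
    defined because the indexing is injective.\<close>
  define u where "u = (\<lambda>x. c (the_inv_into {..n} (\<lambda>i. L (\<sigma> i)) x))"
  have u: "u (L (\<sigma> i)) = c i" if "i \<le> n" for i
    unfolding u_def using the_inv_into_f_f[OF inj'] that by simp
  have "(\<Sum>x\<in>L ` S. Const (u x) * x) = 0"
    unfolding im[symmetric] sum.reindex[OF inj'] using eq u by simp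
  moreover have "finite (L ` S)" unfolding im[symmetric] by simp
  moreover have "L (\<sigma> m) \<in> L ` S" unfolding im[symmetric] using m by simp
  ultimately have "u (L (\<sigma> m)) = 0"
    by (intro mpoly_vs.independentD[OF ind _ subset_refl])
  then show "c m = 0" using u m by simp
qed

lemma span_image_expand:
  fixes L :: "nat \<Rightarrow> 'k::field mpoly"
  assumes "p \<in> mpoly_vs.span (L ` S)" "inj_on L S" "finite S"
  obtains a where "p = (\<Sum>i\<in>S. Const (a i) * L i)"
proof -
  from assms(1) obtain u where "p = (\<Sum>x\<in>L ` S. Const (u x) * x)"
    using mpoly_vs.span_finite[of "L ` S"] assms(3) by auto
  then have "p = (\<Sum>i\<in>S. Const (u (L i)) * L i)" by (simp add: sum.reindex[OF assms(2)])
  then show thesis by (rule that)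
qed


section \<open>Polar maps of products of linear forms\<close>

interpretation subst: comm_ring_hom "subst G :: 'a::comm_ring_1 mpoly \<Rightarrow> 'a mpoly" for G
  unfolding subst_eq_ev by (rule Const.comm_ring_hom_ev)

lemma subst_Const [simp]: "subst G (Const c) = Const (c :: 'a::comm_ring_1)"
  by (simp add: subst_eq_ev)

lemma subst_Var [simp]: "subst G (Var i) = (G i :: 'a::comm_ring_1 mpoly)"
  by (simp add: subst_eq_ev)

lemma comm_ring_hom_const_const: "comm_ring_hom (\<lambda>c :: 'a::comm_ring_1. [:[:c:]:])"
  by unfold_locales (simp_all add: one_pCons)

lemma polar_prod_linear_forms:
  fixes L :: "nat \<Rightarrow> 'a::comm_ring_1 mpoly"
  assumes "\<And>i. i \<le> r \<Longrightarrow> linear_form n (L i)" "j \<le> n"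
  shows "polar (\<Prod>i\<le>r. L i) j = (\<Sum>i\<le>r. Const (Poly_Mapping.lookup (L i) (Poly_Mapping.single j 1)) * (\<Prod>l\<in>{..r} - {i}. L l))"
  unfolding polar_def partial_deriv_prod[OF finite_atMost]
  using assms by (intro sum.cong refl) (simp add: partial_deriv_linear_form[OF assms(1) assms(2)])

text \<open>By Euler's relation the derivatives combine to \<open>r + 1\<close> times the product,
  which is nonzero in characteristic zero.\<close>

lemma polar_prod_linear_forms_nonzero:
  fixes L :: "nat \<Rightarrow> 'a::{idom,ring_char_0} mpoly"
  assumes lin: "\<And>i. i \<le> r \<Longrightarrow> linear_form n (L i)" and nz: "\<And>i. i \<le> r \<Longrightarrow> L i \<noteq> 0"
  shows "\<exists>j\<le>n. polar (\<Prod>i\<le>r. L i) j \<noteq> 0"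
proof (rule ccontr)
  assume "\<not> ?thesis"
  then have "0 = (\<Sum>j\<le>n. Var j * polar (\<Prod>i\<le>r. L i) j)" by simp
  also have "\<dots> = (\<Sum>i\<le>r. \<Sum>j\<le>n. (Const (Poly_Mapping.lookup (L i) (Poly_Mapping.single j 1)) * Var j) * (\<Prod>l\<in>{..r} - {i}. L l))"
    by (subst sum.swap) (simp add: polar_prod_linear_forms[OF lin] sum_distrib_left mult_ac)
  also have "\<dots> = (\<Sum>i\<le>r. \<Prod>l\<le>r. L l)"
  proof (intro sum.cong refl)
    fix i assume i: "i \<in> {..r}"
    then have "(\<Sum>j\<le>n. Const (Poly_Mapping.lookup (L i) (Poly_Mapping.single j 1)) * Var j) = L i"
      using linear_form_expand[OF lin[of i]] by simp
    then show "(\<Sum>j\<le>n. (Const (Poly_Mapping.lookup (L i) (Poly_Mapping.single j 1)) * Var j) * (\<Prod>l\<in>{..r} - {i}. L l)) = (\<Prod>l\<le>r. L l)"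
      using i by (simp add: prod.remove[of "{..r}" i] flip: sum_distrib_right)
  qed
  also have "\<dots> = of_nat (Suc r) * (\<Prod>l\<le>r. L l)" by simp
  finally have "of_nat (Suc r) * (\<Prod>l\<le>r. L l) = 0" ..
  moreover have "(\<Prod>l\<le>r. L l) \<noteq> 0" using nz by simp
  ultimately show False by (simp del: of_nat_Suc)
qed

text \<open>A birational map is dominant: substituting the inverse turns a linear relation between
  the components into one between the variables.\<close>

lemma birational_imp_independent_components:
  fixes M :: "nat \<Rightarrow> 'a::idom mpoly"
  assumes "birational n M" "(\<Sum>j\<le>n. Const (v j) * M j) = 0" "j \<le> n"
  shows "v j = 0"
proof -
  obtain H where "same_rat_map n (rat_comp M H) Var"
    using assms(1) by (auto simp: birational_def)
  then have proport: "subst H (M i) * Var j = subst H (M j) * Var i" if "i \<le> n" "j \<le> n" for i j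
    using that by (simp add: same_rat_map_def rat_comp_def)
  obtain i where i: "i \<le> n" "subst H (M i) \<noteq> 0"
    using \<open>same_rat_map n (rat_comp M H) Var\<close> by (auto simp: same_rat_map_def rat_map_def rat_comp_def)
  have "subst H (M i) * (\<Sum>j\<le>n. Const (v j) * Var j) = (\<Sum>j\<le>n. Const (v j) * (subst H (M i) * Var j))"
    by (simp add: sum_distrib_left mult_ac)
  also have "\<dots> = subst H (\<Sum>j\<le>n. Const (v j) * M j) * Var i"
    using proport[OF i(1)] by (simp add: subst.hom_sum subst.hom_mult sum_distrib_right mult.assoc)
  finally have "(\<Sum>j\<le>n. Const (v j) * Var j) = 0" using assms(2) i by simp
  then show ?thesis using lin_indep_family_Var[of n] assms(3) by (auto simp: lin_indep_family_def)
qed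

text \<open>Passing to the basis forms as coordinates, a left inverse would make the first two
  coordinates of every point proportional to two forms in the gradient there. The arc of
  \<open>degeneration\<close> violates this.\<close>

lemma polar_arrangement_no_left_inverse:
  fixes L :: "nat \<Rightarrow> 'k::field_char_0 mpoly"
  assumes n: "n \<ge> 1"
    and lin: "\<And>i. i \<le> r \<Longrightarrow> linear_form n (L i)" and nz: "\<And>i. i \<le> r \<Longrightarrow> L i \<noteq> 0"
    and \<sigma>: "\<And>m. m \<le> n \<Longrightarrow> \<sigma> m \<le> r"
    and ind: "lin_indep_family n (\<lambda>m. L (\<sigma> m))"
    and span: "\<And>p. linear_form n p \<Longrightarrow> \<exists>a. p = (\<Sum>m\<le>n. Const (a m) * L (\<sigma> m))"
    and s: "s \<le> r" "L s = (\<Sum>m\<le>n. Const (a m) * L (\<sigma> m))" "a 0 \<noteq> 0" "a 1 \<noteq> 0"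
    and H: "\<And>i. i \<le> n \<Longrightarrow> homogeneous n e (H i)"
    and proport: "\<And>i j. i \<le> n \<Longrightarrow> j \<le> n \<Longrightarrow>
      subst (polar (\<Prod>i\<le>r. L i)) (H i) * Var j = subst (polar (\<Prod>i\<le>r. L i)) (H j) * Var i"
  shows "\<forall>i\<le>n. subst (polar (\<Prod>i\<le>r. L i)) (H i) = 0"
proof (rule ccontr)
  let ?G = "polar (\<Prod>i\<le>r. L i)"
  assume "\<not> ?thesis"
  then obtain i0 where i0: "i0 \<le> n" "subst ?G (H i0) \<noteq> 0" by blast
  define A where "A m j = Poly_Mapping.lookup (L (\<sigma> m)) (Poly_Mapping.single j 1)" for m j
  have A: "L (\<sigma> m) = (\<Sum>j\<le>n. Const (A m j) * Var j)" if "m \<le> n" for m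
    using linear_form_expand[OF lin[OF \<sigma>[OF that]]] by (simp add: A_def)
  have "\<forall>j. \<exists>c. j \<le> n \<longrightarrow> Var j = (\<Sum>m\<le>n. Const (c m) * L (\<sigma> m))"
    using span homogeneous_Var by blast
  then obtain C where C: "\<And>j. j \<le> n \<Longrightarrow> Var j = (\<Sum>m\<le>n. Const (C j m) * L (\<sigma> m))" by metis
  have AC: "(\<Sum>j\<le>n. A m j * C j m') = (if m = m' then 1 else 0)" if "m \<le> n" "m' \<le> n" for m m'
    by (rule lin_indep_family_dual[OF ind A C that])
  have "\<forall>i. \<exists>c. i \<le> r \<longrightarrow> L i = (\<Sum>m\<le>n. Const (c m) * L (\<sigma> m))"
    using span lin by blast
  then obtain b where b: "\<And>i. i \<le> r \<Longrightarrow> L i = (\<Sum>m\<le>n. Const (b i m) * L (\<sigma> m))" by metis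
  have b_nz: "\<exists>m\<le>n. b i m \<noteq> 0" if "i \<le> r" for i
  proof (rule ccontr)
    assume "\<not> ?thesis"
    then have "L i = 0" by (subst b[OF that]) simp
    with nz that show False by blast
  qed
  have b_\<sigma>: "b (\<sigma> m) m' = (if m = m' then 1 else 0)" if "m \<le> n" "m' \<le> n" for m m'
  proof (rule lin_indep_familyD[OF ind _ that(2), of "b (\<sigma> m)" "\<lambda>m'. if m = m' then 1 else 0"])
    have "(\<Sum>m'\<le>n. Const (if m = m' then 1 else 0) * L (\<sigma> m')) = (\<Sum>m'\<le>n. if m = m' then L (\<sigma> m') else 0)"
      by (intro sum.cong) auto
    also have "\<dots> = (\<Sum>m'\<le>n. Const (b (\<sigma> m) m') * L (\<sigma> m'))"
      using b[OF \<sigma>[OF that(1)]] that(1) by simp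
    finally show "(\<Sum>m'\<le>n. Const (b (\<sigma> m) m') * L (\<sigma> m')) = (\<Sum>m'\<le>n. Const (if m = m' then 1 else 0) * L (\<sigma> m'))" ..
  qed
  have bs: "b s m = a m" if "m \<le> n" for m
    by (rule lin_indep_familyD[OF ind _ that, of "b s" a]) (simp flip: b[OF s(1)] s(2))
  have bs01: "b s 0 \<noteq> 0" "b s 1 \<noteq> 0" using bs[OF le0] bs[OF n] s(3,4) by auto
  \<comment> \<open>The derivatives of the product in the basis coordinates; \<open>G\<close> is the
    chain rule.\<close>
  define E where "E m = (\<Sum>i\<le>r. Const (b i m) * (\<Prod>l\<in>{..r} - {i}. L l))" for m
  have G: "?G j = (\<Sum>m\<le>n. Const (A m j) * E m)" if j: "j \<le> n" for j
  proof -
    have "Const (Poly_Mapping.lookup (L i) (Poly_Mapping.single j 1)) = (\<Sum>m\<le>n. Const (b i m) * Const (A m j))"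
      if "i \<le> r" for i
    proof -
      have "Poly_Mapping.lookup (L i) (Poly_Mapping.single j 1) = (\<Sum>m\<le>n. b i m * A m j)"
        by (subst b[OF that]) (simp add: lookup_sum lookup_Const_mult A_def)
      then show ?thesis by (simp add: Const.hom_sum Const.hom_mult)
    qed
    then have "?G j = (\<Sum>i\<le>r. \<Sum>m\<le>n. Const (b i m) * Const (A m j) * (\<Prod>l\<in>{..r} - {i}. L l))"
      by (simp add: polar_prod_linear_forms[OF lin j] sum_distrib_right)
    also have "\<dots> = (\<Sum>m\<le>n. Const (A m j) * E m)"
      unfolding E_def sum_distrib_left by (subst sum.swap) (simp add: mult_ac)
    finally show ?thesis .
  qed
  \<comment> \<open>The tuple \<open>H\<close> in the new coordinates: \<open>A\<close> acts on its
    values, the transpose of \<open>A\<close> on its arguments.\<close>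
  define P where "P m = (\<Sum>j\<le>n. Const (A m j) * subst (\<lambda>j'. \<Sum>m'\<le>n. Const (A m' j') * Var m') (H j))" for m
  have homP: "homogeneous n e (P m)" for m
    unfolding P_def
  proof (rule homogeneous_sum)
    fix j assume "j \<in> {..n}"
    have "linear_form n (\<Sum>m'\<le>n. Const (A m' j') * Var m')" for j'
    proof (rule homogeneous_sum)
      fix m' assume "m' \<in> {..n}"
      then show "linear_form n (Const (A m' j') * Var m')"
        using homogeneous_mult[OF homogeneous_Const homogeneous_Var] by fastforce
    qed
    moreover have "homogeneous n e (H j)" using \<open>j \<in> {..n}\<close> by (intro H) simp
    ultimately have "homogeneous n (1 * e) (subst (\<lambda>j'. \<Sum>m'\<le>n. Const (A m' j') * Var m') (H j))"
      by (rule homogeneous_subst[rotated])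
    from homogeneous_mult[OF homogeneous_Const this]
    show "homogeneous n e (Const (A m j) * subst (\<lambda>j'. \<Sum>m'\<le>n. Const (A m' j') * Var m') (H j))"
      by simp
  qed
  \<comment> \<open>\<open>K\<close> is the composition with the polar map and \<open>Z\<close> its
    expression in the basis coordinates, so \<open>Z m\<close> is proportional to the basis form
    itself.\<close>
  define K where "K j = subst ?G (H j)" for j
  define Z where "Z m = (\<Sum>j\<le>n. Const (A m j) * K j)" for m
  have EP: "subst E (P m) = Z m" for m
  proof -
    have "subst E (subst (\<lambda>j'. \<Sum>m'\<le>n. Const (A m' j') * Var m') (H j)) = K j" if "j \<le> n" for j
      unfolding K_def subst_eq_ev Const.ev_subst[unfolded subst_eq_ev]
      using G by (intro ev_homogeneous_cong[OF H[OF that]])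
        (simp add: subst.hom_sum subst.hom_mult flip: subst_eq_ev)
    then show ?thesis by (simp add: P_def Z_def subst.hom_sum subst.hom_mult)
  qed
  have ZK: "Z m * Var i = K i * L (\<sigma> m)" if "i \<le> n" "m \<le> n" for i m
    unfolding Z_def sum_distrib_right A[OF that(2)] sum_distrib_left
    using proport[OF _ that(1)] by (intro sum.cong refl) (simp add: K_def mult_ac)
  have Z_nz: "Z m \<noteq> 0" if "m \<le> n" for m
    using ZK[OF i0(1) that] i0 nz[OF \<sigma>[OF that]] by (auto simp: K_def)
  then have P_nz: "P m \<noteq> 0" if "m \<le> n" for m
    using EP[of m] that by auto
  have Z01: "Z 1 * L (\<sigma> 0) = Z 0 * L (\<sigma> 1)"
  proof -
    have "K i0 * (Z 1 * L (\<sigma> 0)) = Z 1 * (K i0 * L (\<sigma> 0))" by (rule mult.left_commute)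
    also have "\<dots> = Z 1 * (Z 0 * Var i0)" by (simp only: ZK[OF i0(1) le0])
    also have "\<dots> = Z 0 * (Z 1 * Var i0)" by (rule mult.left_commute)
    also have "\<dots> = Z 0 * (K i0 * L (\<sigma> 1))" by (simp only: ZK[OF i0(1) n])
    also have "\<dots> = K i0 * (Z 0 * L (\<sigma> 1))" by (rule mult.left_commute)
    finally show ?thesis using i0 by (simp add: K_def)
  qed
  obtain t :: "nat \<Rightarrow> 'k poly poly" where t:
    "t 0 * ev (\<lambda>c. [:[:c:]:]) (\<lambda>m. \<Sum>i\<le>r. [:[:b i m:]:] * (\<Prod>j\<in>{..r} - {i}. \<Sum>l\<le>n. [:[:b j l:]:] * t l)) (P 1) \<noteq>
     t 1 * ev (\<lambda>c. [:[:c:]:]) (\<lambda>m. \<Sum>i\<le>r. [:[:b i m:]:] * (\<Prod>j\<in>{..r} - {i}. \<Sum>l\<le>n. [:[:b j l:]:] * t l)) (P 0)"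
    by (rule degeneration[OF n b_nz \<sigma> b_\<sigma> s(1) bs01 homP[of 0] homP[of 1] P_nz[OF le0] P_nz[OF n]])
  define \<kappa> where "\<kappa> = (\<lambda>c :: 'k. [:[:c:]:])"
  interpret \<kappa>: comm_ring_hom \<kappa> unfolding \<kappa>_def by (rule comm_ring_hom_const_const)
  \<comment> \<open>The point whose basis coordinates are \<open>t\<close>, found with the inverse
    matrix \<open>C\<close>.\<close>
  define x where "x j = (\<Sum>m\<le>n. \<kappa> (C j m) * t m)" for j
  interpret ev: comm_ring_hom "ev \<kappa> x" by (rule \<kappa>.comm_ring_hom_ev)
  have ev_\<sigma>: "ev \<kappa> x (L (\<sigma> m)) = t m" if "m \<le> n" for m
  proof -
    have "ev \<kappa> x (L (\<sigma> m)) = (\<Sum>j\<le>n. \<kappa> (A m j) * x j)"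
      by (subst A[OF that]) (simp add: ev.hom_sum ev.hom_mult)
    also have "\<dots> = (\<Sum>m'\<le>n. \<kappa> (\<Sum>j\<le>n. A m j * C j m') * t m')"
      unfolding x_def \<kappa>.hom_sum \<kappa>.hom_mult sum_distrib_left sum_distrib_right mult.assoc
      by (rule sum.swap)
    also have "\<dots> = (\<Sum>m'\<le>n. if m = m' then t m' else 0)"
      using AC[OF that] by (intro sum.cong) auto
    finally show ?thesis using that by simp
  qed
  have ev_L: "ev \<kappa> x (L i) = (\<Sum>l\<le>n. \<kappa> (b i l) * t l)" if "i \<le> r" for i
    by (subst b[OF that]) (simp add: ev.hom_sum ev.hom_mult ev_\<sigma>)
  have ev_E: "ev \<kappa> x (E m) = (\<Sum>i\<le>r. \<kappa> (b i m) * (\<Prod>j\<in>{..r} - {i}. \<Sum>l\<le>n. \<kappa> (b j l) * t l))" for m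
    by (simp add: E_def ev.hom_sum ev.hom_mult ev.hom_prod ev_L)
  have ev_Z: "ev \<kappa> x (Z m) = ev \<kappa> (\<lambda>m. \<Sum>i\<le>r. \<kappa> (b i m) * (\<Prod>j\<in>{..r} - {i}. \<Sum>l\<le>n. \<kappa> (b j l) * t l)) (P m)" for m
    by (simp add: \<kappa>.ev_subst ev_E flip: EP)
  have "ev \<kappa> x (L (\<sigma> 0)) * ev \<kappa> x (Z 1) = ev \<kappa> x (L (\<sigma> 1)) * ev \<kappa> x (Z 0)"
    using arg_cong[OF Z01, of "ev \<kappa> x"] by (simp add: ev.hom_mult mult.commute)
  then show False
    using t n unfolding ev_Z ev_\<sigma>[OF le0] ev_\<sigma>[OF n] by (simp add: \<kappa>_def)
qed

section \<open>Square-free products and the standard Cremona transformation\<close>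

lemma linear_form_not_unit:
  assumes "linear_form n (p :: 'a::comm_ring_1 mpoly)"
  shows "\<not> p dvd 1"
proof
  assume "p dvd 1"
  then obtain q where q: "1 = p * q" by (auto elim: dvdE)
  \<comment> \<open>A linear form vanishes at the origin, a unit does not.\<close>
  have "subst (\<lambda>_. 0) p = 0"
    by (subst linear_form_expand[OF assms]) (simp add: subst.hom_sum subst.hom_mult)
  with arg_cong[OF q, of "subst (\<lambda>_. 0)"] show False by (simp add: subst.hom_mult)
qed

text \<open>Otherwise the square of the non-unit \<open>L j\<close> would divide the
  product.\<close>

lemma squarefree_prod_not_proportional:
  fixes L :: "nat \<Rightarrow> 'a::comm_ring_1 mpoly"
  assumes "squarefree (\<Prod>i\<le>r. L i)" "linear_form n (L j)" "i \<le> r" "j \<le> r" "i \<noteq> j"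
  shows "L i \<noteq> Const c * L j"
proof
  assume L: "L i = Const c * L j"
  have "(\<Prod>i\<le>r. L i) = L i * (L j * (\<Prod>l\<in>{..r} - {i} - {j}. L l))"
    using assms(3-5) prod.remove[of "{..r}" i L] prod.remove[of "{..r} - {i}" j L] by simp
  also have "\<dots> = (L j)\<^sup>2 * (Const c * (\<Prod>l\<in>{..r} - {i} - {j}. L l))"
    unfolding L by (simp add: power2_eq_square mult_ac)
  finally have "(L j)\<^sup>2 dvd (\<Prod>i\<le>r. L i)" by simp
  with assms(1) have "L j dvd 1" unfolding squarefree_def by blast
  with linear_form_not_unit[OF assms(2)] show False by blast
qed

text \<open>Serves to number a basis so that two chosen members get the indices 0 and 1, which the
  degeneration singles out.\<close>

lemma ex_bij_betw_two_values:
  assumes "card S = Suc n" "p \<in> S" "q \<in> S" "p \<noteq> q"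
  obtains \<sigma> :: "nat \<Rightarrow> 'a" where "bij_betw \<sigma> {..n} S" "\<sigma> 0 = p" "\<sigma> 1 = q"
proof -
  have fin: "finite S" using assms(1) by (metis card.infinite nat.distinct(1))
  have "card {p, q} \<le> card S" using assms fin by (intro card_mono) auto
  then have n: "n \<ge> 1" using assms by simp
  have "card (S - {p, q}) = card {2..n}" using assms fin n by (simp add: card_Diff_subset)
  then obtain h where h: "bij_betw h {2..n} (S - {p, q})"
    using fin by (metis finite_Diff finite_atLeastAtMost finite_same_card_bij)
  define \<sigma> where "\<sigma> = h(0 := p, 1 := q)"
  have split: "{..n} = {0, 1} \<union> {2..n}" using n by auto
  have "bij_betw \<sigma> {2..n} (S - {p, q})"
    using h by (rule bij_betw_cong[THEN iffD1, rotated]) (simp add: \<sigma>_def)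
  moreover have "bij_betw \<sigma> {0, 1} {p, q}"
    using assms(4) by (simp add: bij_betw_def \<sigma>_def)
  ultimately have "bij_betw \<sigma> ({0, 1} \<union> {2..n}) ({p, q} \<union> (S - {p, q}))"
    by (intro bij_betw_combine) auto
  moreover have "{p, q} \<union> (S - {p, q}) = S" using assms by auto
  ultimately show thesis using that[of \<sigma>] by (simp add: split \<sigma>_def)
qed

lemma same_rat_mapI:
  fixes G H :: "nat \<Rightarrow> 'a::comm_ring_1 mpoly"
  assumes "rat_map n G" "\<And>i. i \<le> n \<Longrightarrow> G i = H i"
  shows "same_rat_map n G H"
proof -
  have "rat_map n H" using assms unfolding rat_map_def by metis
  then show ?thesis using assms by (simp add: same_rat_map_def mult.commute)
qed

text \<open>In the coordinates given by the forms the product is that of all coordinates, and by the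
  chain rule its gradient returns to the old coordinates through the transpose of
  \<open>A\<close>.\<close>

lemma polar_basis_standard_cremona:
  fixes L :: "nat \<Rightarrow> 'k::field_char_0 mpoly"
  assumes lin: "\<And>i. i \<le> n \<Longrightarrow> linear_form n (L i)" and nz: "\<And>i. i \<le> n \<Longrightarrow> L i \<noteq> 0"
    and ind: "lin_indep_family n L"
    and span: "\<And>p. linear_form n p \<Longrightarrow> \<exists>a. p = (\<Sum>m\<le>n. Const (a m) * L m)"
  shows "rat_map n (polar (\<Prod>i\<le>n. L i))" "standard_cremona n (polar (\<Prod>i\<le>n. L i))"
proof -
  define a where "a m j = Poly_Mapping.lookup (L m) (Poly_Mapping.single j 1)" for m j
  have L: "L m = (\<Sum>j\<le>n. Const (a m j) * Var j)" if "m \<le> n" for m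
    using linear_form_expand[OF lin[OF that]] by (simp add: a_def)
  have polar: "polar (\<Prod>i\<le>n. L i) j = (\<Sum>i\<le>n. Const (a i j) * (\<Prod>l\<in>{..n} - {i}. L l))" if "j \<le> n" for j
    unfolding a_def by (rule polar_prod_linear_forms[OF lin that])
  show rat: "rat_map n (polar (\<Prod>i\<le>n. L i))"
    unfolding rat_map_def
  proof (rule conjI, intro exI allI impI)
    fix j assume "j \<le> n"
    \<comment> \<open>The degree of a constant times a product of \<open>n\<close> linear
      forms.\<close>
    show "homogeneous n (0 + n) (polar (\<Prod>i\<le>n. L i) j)"
      unfolding polar[OF \<open>j \<le> n\<close>]
    proof (intro homogeneous_sum homogeneous_mult homogeneous_Const)
      fix i assume "i \<in> {..n}"
      then have "(\<Sum>l\<in>{..n} - {i}. 1 :: nat) = n" by simp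
      moreover have "homogeneous n (\<Sum>l\<in>{..n} - {i}. 1) (\<Prod>l\<in>{..n} - {i}. L l)"
        using lin by (intro homogeneous_prod) auto
      ultimately show "homogeneous n n (\<Prod>l\<in>{..n} - {i}. L l)" by simp
    qed
  next
    show "\<exists>i\<le>n. polar (\<Prod>i\<le>n. L i) i \<noteq> 0"
      by (rule polar_prod_linear_forms_nonzero[OF lin nz])
  qed
  have "\<forall>j. \<exists>c. j \<le> n \<longrightarrow> Var j = (\<Sum>m\<le>n. Const (c m) * L m)"
    using span homogeneous_Var by blast
  then obtain c where c: "\<And>j. j \<le> n \<Longrightarrow> Var j = (\<Sum>m\<le>n. Const (c j m) * L m)" by metis
  define A where "A = mat (Suc n) (Suc n) (\<lambda>(m, j). a m j)"
  define C where "C = mat (Suc n) (Suc n) (\<lambda>(j, m). c j m)"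
  have carrier: "A \<in> carrier_mat (Suc n) (Suc n)" "C \<in> carrier_mat (Suc n) (Suc n)"
    by (simp_all add: A_def C_def)
  have range: "{0..<Suc n} = {..n}" by auto
  have AC: "A * C = 1\<^sub>m (Suc n)"
    using lin_indep_family_dual[OF ind L c]
    by (intro eq_matI) (auto simp: A_def C_def scalar_prod_def range less_Suc_eq_le)
  have CA: "C * A = 1\<^sub>m (Suc n)"
    using lin_indep_family_dual[OF lin_indep_family_Var c L]
    by (intro eq_matI) (auto simp: A_def C_def scalar_prod_def range less_Suc_eq_le)
  have inv: "invertible_mat A"
    unfolding invertible_mat_def inverts_mat_def square_mat.simps using carrier AC CA by auto
  have lm: "linear_map n A m = L m" if "m \<le> n" for m
    using that by (simp add: linear_map_def L A_def)
  have prod_lm: "(\<Prod>l\<in>{..n} - {i}. linear_map n A l) = (\<Prod>l\<in>{..n} - {i}. L l)" for i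
    using lm by (intro prod.cong) auto
  have transpose: "transpose_mat A $$ (j, i) = a i j" if "i \<le> n" "j \<le> n" for i j
    using that by (simp add: A_def)
  have "rat_comp (linear_map n (transpose_mat A)) (rat_comp (cremona_tuple n) (linear_map n A)) j =
      polar (\<Prod>i\<le>n. L i) j" if "j \<le> n" for j
    using that unfolding polar[OF that] rat_comp_def linear_map_def[of n "transpose_mat A"]
    by (simp add: subst.hom_sum subst.hom_mult cremona_tuple_def subst.hom_prod prod_lm transpose)
  then have "same_rat_map n (polar (\<Prod>i\<le>n. L i))
      (rat_comp (linear_map n (transpose_mat A)) (rat_comp (cremona_tuple n) (linear_map n A)))"
    by (intro same_rat_mapI rat) simp
  then show "standard_cremona n (polar (\<Prod>i\<le>n. L i))"
    unfolding standard_cremona_def using carrier(1) inv by blast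
qed

lemma linear_map_one: "i \<le> n \<Longrightarrow> linear_map n (1\<^sub>m (Suc n)) i = (Var i :: 'a::comm_ring_1 mpoly)"
proof -
  assume i: "i \<le> n"
  have "linear_map n (1\<^sub>m (Suc n)) i = (\<Sum>j\<le>n. if i = j then Var j else (0 :: 'a mpoly))"
    unfolding linear_map_def using i by (intro sum.cong refl) (auto simp: less_Suc_eq_le)
  with i show ?thesis by simp
qed

lemma projectivity_one: "projectivity n (linear_map n (1\<^sub>m (Suc n)) :: nat \<Rightarrow> 'a::comm_ring_1 mpoly)"
  unfolding projectivity_def
proof (intro bexI conjI same_rat_mapI)
  show "invertible_mat (1\<^sub>m (Suc n) :: 'a mat)"
    unfolding invertible_mat_def inverts_mat_def square_mat.simps
    by (intro conjI exI[of _ "1\<^sub>m (Suc n)"]) auto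
  have "Var 0 \<noteq> (0 :: 'a mpoly)" unfolding Var_def by (metis lookup_single_eq lookup_zero zero_neq_one)
  then show "rat_map n (linear_map n (1\<^sub>m (Suc n)) :: nat \<Rightarrow> 'a mpoly)"
    unfolding rat_map_def using homogeneous_Var by (metis le0 linear_map_one)
qed auto

theorem theoremA:
  fixes n r :: nat
    and L :: "nat \<Rightarrow> 'k::field_char_0 mpoly"
    and F :: "'k mpoly"
  assumes "n \<ge> 1"
    and "\<And>i. i \<le> r \<Longrightarrow> linear_form n (L i)"
    and "\<And>i. i \<le> r \<Longrightarrow> L i \<noteq> 0"
    and "F = (\<Prod>i\<le>r. L i)"
    and "squarefree F"
    and "homaloidal n F"
  shows "r = n \<and> lin_indep_family r L \<and>
    (\<exists>P S. projectivity n P \<and> standard_cremona n S \<and> same_rat_map n (polar F) (rat_comp P S))"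
proof -
  note lin = assms(2) and nz = assms(3)
  obtain M where "moving_part n (polar F) M" and M: "birational n M"
    using assms(6) by (auto simp: homaloidal_def)
  then obtain D where D: "\<And>j. j \<le> n \<Longrightarrow> polar F j = D * M j" by (auto simp: moving_part_def)
  have "\<exists>j\<le>n. polar F j \<noteq> 0"
    unfolding assms(4) by (rule polar_prod_linear_forms_nonzero[OF lin nz])
  then have D0: "D \<noteq> 0" using D by auto
  show ?thesis
  proof (rule linear_forms_basis_or_kernel[OF lin])
    fix v
    assume v: "\<exists>j\<le>n. v j \<noteq> 0"
      and ker: "\<And>i. i \<le> r \<Longrightarrow> (\<Sum>j\<le>n. Poly_Mapping.lookup (L i) (Poly_Mapping.single j 1) * v j) = 0"
    \<comment> \<open>The derivative of \<open>F\<close> in the direction \<open>v\<close> vanishes,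
      as \<open>v\<close> is a zero of every factor; cancelling \<open>D\<close> gives a linear
      relation between the components of the birational map.\<close>
    have "D * (\<Sum>j\<le>n. Const (v j) * M j) = (\<Sum>j\<le>n. Const (v j) * polar F j)"
      by (simp add: D sum_distrib_left mult.left_commute)
    also have "\<dots> = (\<Sum>j\<le>n. \<Sum>i\<le>r. Const (Poly_Mapping.lookup (L i) (Poly_Mapping.single j 1) * v j) * (\<Prod>l\<in>{..r} - {i}. L l))"
    proof (rule sum.cong[OF refl])
      fix j assume "j \<in> {..n}"
      then have "polar F j = (\<Sum>i\<le>r. Const (Poly_Mapping.lookup (L i) (Poly_Mapping.single j 1)) * (\<Prod>l\<in>{..r} - {i}. L l))"
        unfolding assms(4) using polar_prod_linear_forms[of r n L j] lin by blast
      then show "Const (v j) * polar F j = (\<Sum>i\<le>r. Const (Poly_Mapping.lookup (L i) (Poly_Mapping.single j 1) * v j) * (\<Prod>l\<in>{..r} - {i}. L l))"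
        by (simp only: sum_distrib_left Const.hom_mult mult.assoc mult.left_commute)
    qed
    also have "\<dots> = (\<Sum>i\<le>r. \<Sum>j\<le>n. Const (Poly_Mapping.lookup (L i) (Poly_Mapping.single j 1) * v j) * (\<Prod>l\<in>{..r} - {i}. L l))"
      by (rule sum.swap)
    also have "\<dots> = (\<Sum>i\<le>r. Const (\<Sum>j\<le>n. Poly_Mapping.lookup (L i) (Poly_Mapping.single j 1) * v j) * (\<Prod>l\<in>{..r} - {i}. L l))"
      by (simp only: Const.hom_sum sum_distrib_right)
    also have "\<dots> = 0" by (intro sum.neutral) (simp add: ker del: One_nat_def)
    finally have "(\<Sum>j\<le>n. Const (v j) * M j) = 0" using D0 by simp
    with birational_imp_independent_components[OF M] v show ?thesis by blast
  next
    fix S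
    assume S: "S \<subseteq> {..r}" "card S = Suc n" "inj_on L S" "mpoly_vs.independent (L ` S)"
      and span: "\<And>p. linear_form n p \<Longrightarrow> p \<in> mpoly_vs.span (L ` S)"
    have finS: "finite S" using S(1) finite_subset by blast
    have "S = {..r}"
    proof (rule ccontr)
      assume "S \<noteq> {..r}"
      then obtain s where s: "s \<le> r" "s \<notin> S" using S(1) by auto
      obtain a where a: "L s = (\<Sum>i\<in>S. Const (a i) * L i)"
        using span_image_expand[OF span[OF lin[OF s(1)]] S(3) finS] by blast
      have "\<exists>p\<in>S. a p \<noteq> 0"
      proof (rule ccontr)
        assume "\<not> ?thesis"
        then have "L s = 0" by (simp add: a)
        with nz s show False by blast
      qed
      then obtain p where p: "p \<in> S" "a p \<noteq> 0" by blast
      \<comment> \<open>With a single nonzero coefficient the form \<open>L s\<close> would be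
        proportional to \<open>L p\<close>, against square-freeness.\<close>
      have "\<exists>q\<in>S - {p}. a q \<noteq> 0"
      proof (rule ccontr)
        assume "\<not> ?thesis"
        then have "L s = Const (a p) * L p"
          unfolding a sum.remove[OF finS p(1)] by simp
        moreover have "p \<le> r" "s \<noteq> p" using S(1) p s by auto
        ultimately show False
          using squarefree_prod_not_proportional[of L r n p s "a p"] assms(4,5) lin s(1) by blast
      qed
      then obtain q where q: "q \<in> S" "p \<noteq> q" "a q \<noteq> 0" by blast
      obtain \<sigma> where \<sigma>: "bij_betw \<sigma> {..n} S" "\<sigma> 0 = p" "\<sigma> 1 = q"
        using ex_bij_betw_two_values[OF S(2) p(1) q(1,2)] by blast
      have reindex: "(\<Sum>i\<in>S. Const (c i) * L i) = (\<Sum>m\<le>n. Const (c (\<sigma> m)) * L (\<sigma> m))" for c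
        by (rule sum.reindex_bij_betw[OF \<sigma>(1), symmetric])
      obtain H where H: "rat_map n H" "same_rat_map n (rat_comp H M) Var"
        using M by (auto simp: birational_def)
      obtain e where e: "\<And>i. i \<le> n \<Longrightarrow> homogeneous n e (H i)" using H(1) by (auto simp: rat_map_def)
      \<comment> \<open>Removing the common factor changes the values of the forms
        \<open>H i\<close> only by the power \<open>D ^ e\<close>, so a left inverse of the moving
        part also inverts the polar map.\<close>
      have scale: "subst (polar F) (H i) = D ^ e * subst M (H i)" if "i \<le> n" for i
        unfolding subst_eq_ev ev_homogeneous_scale[OF e[OF that], symmetric]
        using D by (rule ev_homogeneous_cong[OF e[OF that]])
      have "\<forall>i\<le>n. subst (polar (\<Prod>i\<le>r. L i)) (H i) = 0"
      proof (rule polar_arrangement_no_left_inverse[of n r L \<sigma> s "\<lambda>m. a (\<sigma> m)" e H])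
        show "\<sigma> m \<le> r" if "m \<le> n" for m
          using bij_betwE[OF \<sigma>(1)] S(1) that by blast
        show "lin_indep_family n (\<lambda>m. L (\<sigma> m))"
          by (rule independent_image_lin_indep_family[OF S(4,3) \<sigma>(1)])
        show "\<exists>c. f = (\<Sum>m\<le>n. Const (c m) * L (\<sigma> m))" if f: "linear_form n f" for f
        proof -
          obtain c where "f = (\<Sum>i\<in>S. Const (c i) * L i)"
            using span_image_expand[OF span[OF f] S(3) finS] by blast
          then show ?thesis unfolding reindex by (rule exI[of _ "\<lambda>m. c (\<sigma> m)"])
        qed
        show "L s = (\<Sum>m\<le>n. Const (a (\<sigma> m)) * L (\<sigma> m))" using a unfolding reindex .
        show "subst (polar (\<Prod>i\<le>r. L i)) (H i) * Var j = subst (polar (\<Prod>i\<le>r. L i)) (H j) * Var i"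
          if "i \<le> n" "j \<le> n" for i j
        proof -
          have "subst M (H i) * Var j = subst M (H j) * Var i"
            using H(2) that by (simp add: same_rat_map_def rat_comp_def)
          then show ?thesis
            unfolding assms(4)[symmetric] scale[OF that(1)] scale[OF that(2)] mult.assoc by (rule arg_cong)
        qed
      qed (use assms(1) lin nz s e \<sigma> p q in auto)
      then have "subst M (H i) = 0" if "i \<le> n" for i
        using scale[OF that] that D0 by (simp flip: assms(4))
      then show False using H(2) by (auto simp: same_rat_map_def rat_map_def rat_comp_def)
    qed
    then have r: "r = n" using S(2) by simp
    have id: "bij_betw id {..n} S" using \<open>S = {..r}\<close> r by simp
    have ind: "lin_indep_family n L"
      using independent_image_lin_indep_family[OF S(4,3) id] by simp
    have "\<exists>c. f = (\<Sum>m\<le>n. Const (c m) * L m)" if f: "linear_form n f" for f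
      using span_image_expand[OF span[OF f] S(3) finS] \<open>S = {..r}\<close> r by metis
    have "rat_map n (polar F)" "standard_cremona n (polar F)"
      using polar_basis_standard_cremona[of n L] lin nz ind \<open>\<And>f. linear_form n f \<Longrightarrow> \<exists>c. f = (\<Sum>m\<le>n. Const (c m) * L m)\<close>
      unfolding assms(4) r by blast+
    \<comment> \<open>The identity serves as projectivity, since \<open>standard_cremona\<close>
      already contains the change of coordinates.\<close>
    moreover have "same_rat_map n (polar F) (rat_comp (linear_map n (1\<^sub>m (Suc n))) (polar F))"
      by (intro same_rat_mapI \<open>rat_map n (polar F)\<close>) (simp add: rat_comp_def linear_map_one)
    ultimately show ?thesis using r ind projectivity_one by blast
  qed
qed

end
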